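(* Let $\mathbb{D},\mathbb{D}'$ be division rings and $m,n,m',n'\ge1$ integers. Put $s=\max\{m,n\}$ and $k=\max\{m',n'\}$. Then there exists a graph homomorphism from $\mathbb{D}^{m\times n}$ to $\mathbb{D}'^{m'\times n'}$ if and only if $|\mathbb{D}|^s\le|\mathbb{D}'|^k$ (as cardinal numbers).
   Context: $\mathbb{D}^{m\times n}$ is the set of $m\times n$ matrices over $\mathbb{D}$; $A,B$ are adjacent if $\operatorname{rank}(A-B)=1$. A graph homomorphism $\varphi:\mathbb{D}^{m\times n}\to\mathbb{D}'^{m'\times n'}$ is a map such that $\operatorname{rank}(A-B)=1$ implies $\operatorname{rank}(\varphi(A)-\varphi(B))=1$. *)

theory Defs
  imports Jordan_Normal_Form.Matrix "HOL-Library.FuncSet"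
begin

unbundle cardinal_syntax

text \<open>
  Coefficients act on rows from the left.  Over a division ring the maximal number of
  left linearly independent rows equals the maximal number of right linearly independent
  columns, but not in general the corresponding number with the sides exchanged.
\<close>

definition rows_left_independent :: "'a::division_ring mat \<Rightarrow> nat set \<Rightarrow> bool" where
  "rows_left_independent A I \<longleftrightarrow>
     (\<forall>c :: nat \<Rightarrow> 'a. (\<forall>j < dim_col A. (\<Sum>i\<in>I. c i * A $$ (i, j)) = 0) \<longrightarrow> (\<forall>i\<in>I. c i = 0))"

definition mat_rank :: "'a::division_ring mat \<Rightarrow> nat" where
  "mat_rank A = Max {card I | I. I \<subseteq> {..<dim_row A} \<and> rows_left_independent A I}"

definition adjacent :: "'a::division_ring mat \<Rightarrow> 'a mat \<Rightarrow> bool" where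
  "adjacent A B \<longleftrightarrow> mat_rank (A - B) = 1"

definition graph_hom ::
  "nat \<Rightarrow> nat \<Rightarrow> nat \<Rightarrow> nat \<Rightarrow> ('a::division_ring mat \<Rightarrow> 'b::division_ring mat) \<Rightarrow> bool" where
  "graph_hom m n m' n' \<phi> \<longleftrightarrow>
     \<phi> \<in> carrier_mat m n \<rightarrow> carrier_mat m' n' \<and>
     (\<forall>A \<in> carrier_mat m n. \<forall>B \<in> carrier_mat m n. adjacent A B \<longrightarrow> adjacent (\<phi> A) (\<phi> B))"

end

theory Submission
  imports Defs "HOL-Algebra.Algebraic_Closure_Type" "HOL-Number_Theory.Cong"
begin

text \<open>
  A full row or column of entries is a clique of size \<open>|D| ^ s\<close>.  Conversely, cliques of
  matrices have at most \<open>|D'| ^ k\<close> elements, because the differences from a fixed member are rank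
  one matrices with a common column space or a common row space.  A homomorphism is injective
  on cliques, whence the inequality.

  For the converse it suffices to colour the source graph properly with \<open>|D| ^ s\<close> colours and to
  send the colours injectively into a clique of the target.  For infinite \<open>D\<close> each matrix gets its
  own colour.  A finite \<open>D\<close> is a field by Wedderburn's theorem; with a basis \<open>b\<close> of its extension
  of degree \<open>s\<close>, the colour of \<open>A\<close> is the element \<open>\<Sum> b i * A i j * b j\<close> of that extension.  A rank
  one difference \<open>u i * v j\<close> yields a product of two nonzero elements, so adjacent matrices
  receive different colours.
\<close>

hide_const (open) Divisibility.prime Coset.order Polynomials.degree Polynomials.lead_coeff
  module.smult up_ring.monom up_ring.coeff

section \<open>Matrices of rank one\<close>

definition outer :: "nat \<Rightarrow> nat \<Rightarrow> (nat \<Rightarrow> 'a::division_ring) \<Rightarrow> (nat \<Rightarrow> 'a) \<Rightarrow> 'a mat" where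
  "outer m n u v = mat m n (\<lambda>(i, j). u i * v j)"

lemma outer_carrier [simp]: "outer m n u v \<in> carrier_mat m n"
  by (simp add: outer_def)

lemma dim_outer [simp]: "dim_row (outer m n u v) = m" "dim_col (outer m n u v) = n"
  by (simp_all add: outer_def)

lemma outer_index [simp]: "i < m \<Longrightarrow> j < n \<Longrightarrow> outer m n u v $$ (i, j) = u i * v j"
  by (simp add: outer_def)

lemma finite_card_independent_rows:
  "finite {card I | I. I \<subseteq> {..<dim_row A} \<and> rows_left_independent A I}"
  by (rule finite_subset[of _ "card ` Pow {..<dim_row A}"]) auto

lemma rows_left_independent_empty [simp]: "rows_left_independent A {}"
  by (simp add: rows_left_independent_def)

lemma mat_rank_attained:
  obtains I where "I \<subseteq> {..<dim_row A}" "rows_left_independent A I" "card I = mat_rank A"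
proof -
  have "mat_rank A \<in> {card I | I. I \<subseteq> {..<dim_row A} \<and> rows_left_independent A I}"
    unfolding mat_rank_def
    by (rule Max_in[OF finite_card_independent_rows]) (use rows_left_independent_empty in blast)
  with that show thesis by auto
qed

lemma card_le_mat_rank:
  "I \<subseteq> {..<dim_row A} \<Longrightarrow> rows_left_independent A I \<Longrightarrow> card I \<le> mat_rank A"
  unfolding mat_rank_def by (rule Max_ge[OF finite_card_independent_rows]) auto

lemma rows_left_independent_singleton:
  "rows_left_independent A {i} \<longleftrightarrow> (\<exists>j<dim_col A. A $$ (i, j) \<noteq> 0)"
proof
  assume "rows_left_independent A {i}"
  then show "\<exists>j<dim_col A. A $$ (i, j) \<noteq> 0"
    unfolding rows_left_independent_def by (auto dest: spec[of _ "\<lambda>_. 1"])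
qed (auto simp: rows_left_independent_def)

text \<open>Pick an independent row \<open>r\<close>. Rank one makes every pair
  \<open>{r, i}\<close> dependent, so row \<open>i\<close> is a left multiple of row
  \<open>r\<close>. The multipliers form \<open>u\<close>, and row \<open>r\<close> is
  \<open>v\<close>.\<close>

lemma mat_rank_eq_1_imp_outer:
  assumes A: "A \<in> carrier_mat m n" and rank: "mat_rank A = 1"
  obtains u v where "A = outer m n u v" "A \<noteq> 0\<^sub>m m n"
proof -
  obtain I where "I \<subseteq> {..<m}" "rows_left_independent A I" "card I = 1"
    using mat_rank_attained[of A] rank A by (metis carrier_matD(1))
  then obtain r where r: "r < m" and "rows_left_independent A {r}"
    by (auto simp: card_1_singleton_iff)
  then obtain l where l: "l < n" "A $$ (r, l) \<noteq> 0"
    using A by (auto simp: rows_left_independent_singleton)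
  have "\<exists>a. \<forall>j<n. A $$ (i, j) = a * A $$ (r, j)" if i: "i < m" for i
  proof (cases "i = r")
    case True
    then show ?thesis by (intro exI[of _ 1]) simp
  next
    case False
    have "\<not> rows_left_independent A {r, i}"
      using card_le_mat_rank[of "{r, i}" A] A r i rank False by auto
    then obtain c where c: "\<And>j. j < n \<Longrightarrow> c r * A $$ (r, j) + c i * A $$ (i, j) = 0"
      and "c r \<noteq> 0 \<or> c i \<noteq> 0"
      using A False by (auto simp: rows_left_independent_def)
    \<comment> \<open>If \<open>c i\<close> vanished, the relation at column \<open>l\<close> would
      force \<open>c r = 0\<close> as well.\<close>
    with l have ci: "c i \<noteq> 0" by fastforce
    have "A $$ (i, j) = - (inverse (c i) * c r) * A $$ (r, j)" if "j < n" for j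
    proof -
      have "c i * A $$ (i, j) = - (c r * A $$ (r, j))"
        using c[OF that] by (simp add: eq_neg_iff_add_eq_0 add.commute)
      then have "inverse (c i) * (c i * A $$ (i, j)) = inverse (c i) * - (c r * A $$ (r, j))"
        by simp
      with ci show ?thesis by (simp add: mult.assoc[symmetric])
    qed
    then show ?thesis by blast
  qed
  then obtain u where "\<And>i j. i < m \<Longrightarrow> j < n \<Longrightarrow> A $$ (i, j) = u i * A $$ (r, j)"
    by metis
  then have "A = outer m n u (\<lambda>j. A $$ (r, j))"
    using A by (intro eq_matI) auto
  moreover have "A \<noteq> 0\<^sub>m m n" using l r by auto
  ultimately show thesis by (rule that)
qed

text \<open>All rows are left multiples of \<open>v\<close>, so two of them always satisfy a
  nontrivial left relation, while a nonzero entry makes its own row independent.\<close>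

lemma mat_rank_outer:
  assumes nz: "outer m n u v \<noteq> 0\<^sub>m m n"
  shows "mat_rank (outer m n u v) = 1"
proof (rule antisym)
  let ?A = "outer m n u v"
  obtain I where I: "I \<subseteq> {..<m}" "rows_left_independent ?A I" "card I = mat_rank ?A"
    using mat_rank_attained[of ?A] by (auto simp: outer_def)
  have fin: "finite I" using I(1) finite_subset by blast
  have ind: "\<And>c. (\<forall>j<n. (\<Sum>i\<in>I. c i * (u i * v j)) = 0) \<Longrightarrow> \<forall>i\<in>I. c i = 0"
    using I(1,2) unfolding rows_left_independent_def outer_def
    by (auto simp: subset_iff)
  have "i = k" if ik: "i \<in> I" "k \<in> I" for i k
  proof (rule ccontr)
    assume neq: "i \<noteq> k"
    have expand: "(\<Sum>l\<in>I. c l * (u l * w)) = c i * (u i * w) + c k * (u k * w)"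
      if "\<And>l. l \<notin> {i, k} \<Longrightarrow> c l = 0" for c :: "nat \<Rightarrow> 'a" and w
    proof -
      have "(\<Sum>l\<in>I. c l * (u l * w)) = (\<Sum>l\<in>{i, k}. c l * (u l * w))"
        by (rule sum.mono_neutral_right) (use fin ik that in auto)
      with neq show ?thesis by simp
    qed
    show False
    proof (cases "u i = 0")
      \<comment> \<open>Row \<open>i\<close> is zero, so the coefficient 1 on it alone is already a
        nontrivial relation.\<close>
      case True
      let ?c = "\<lambda>l. if l = i then 1 else 0 :: 'a"
      have "\<forall>j<n. (\<Sum>l\<in>I. ?c l * (u l * v j)) = 0"
        by (subst expand) (use True neq in auto)
      from ind[OF this] ik show False by auto
    next
      case False
      \<comment> \<open>Row \<open>k\<close> minus the left multiple of row \<open>i\<close> that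
        equals it.\<close>
      let ?c = "\<lambda>l. if l = k then 1 else if l = i then - (u k * inverse (u i)) else 0"
      have cancel: "- (u k * inverse (u i)) * (u i * w) + u k * w = 0" for w
      proof -
        have "u k * inverse (u i) * (u i * w) = u k * (inverse (u i) * u i) * w"
          by (simp only: mult.assoc)
        with False show ?thesis by simp
      qed
      have "(\<Sum>l\<in>I. ?c l * (u l * w)) = 0" for w
      proof -
        have "(\<Sum>l\<in>I. ?c l * (u l * w)) = ?c i * (u i * w) + ?c k * (u k * w)"
          by (rule expand) simp
        also have "\<dots> = - (u k * inverse (u i)) * (u i * w) + u k * w"
          using neq by (simp only: if_False if_True mult_1_left simp_thms)
        finally show ?thesis by (simp only: cancel)
      qed
      then have "\<forall>j<n. (\<Sum>l\<in>I. ?c l * (u l * v j)) = 0" by blast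
      from ind[OF this] ik show False by auto
    qed
  qed
  then have "card I \<le> 1" using fin by (simp add: card_le_Suc0_iff_eq)
  with I(3) show "mat_rank ?A \<le> 1" by simp
next
  let ?A = "outer m n u v"
  have "\<exists>i<m. \<exists>j<n. ?A $$ (i, j) \<noteq> 0"
  proof (rule ccontr)
    assume "\<not> ?thesis"
    then have "?A = 0\<^sub>m m n" by (intro eq_matI) (auto simp: outer_def)
    with nz show False ..
  qed
  then obtain i where "i < m" "rows_left_independent ?A {i}"
    by (auto simp: rows_left_independent_singleton outer_def)
  then show "1 \<le> mat_rank ?A"
    using card_le_mat_rank[of "{i}" ?A] by (auto simp: outer_def)
qed

text \<open>This replaces the rank in later arguments: adjacency is handled only through outer
  products.\<close>

lemma adjacent_iff_outer:
  assumes "A \<in> carrier_mat m n" "B \<in> carrier_mat m n"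
  shows "adjacent A B \<longleftrightarrow> A \<noteq> B \<and> (\<exists>u v. A - B = outer m n u v)"
proof -
  have eq: "A - B = 0\<^sub>m m n \<longleftrightarrow> A = B"
  proof
    assume *: "A - B = 0\<^sub>m m n"
    have "A $$ (i, j) = B $$ (i, j)" if "i < m" "j < n" for i j
      using arg_cong[OF *, of "\<lambda>M. M $$ (i, j)"] assms that by simp
    with assms show "A = B" by (intro eq_matI) auto
  qed (use assms in auto)
  show ?thesis
  proof
    assume "adjacent A B"
    then have "mat_rank (A - B) = 1" by (simp add: adjacent_def)
    then obtain u v where "A - B = outer m n u v" "A - B \<noteq> 0\<^sub>m m n"
      by (rule mat_rank_eq_1_imp_outer[OF minus_carrier_mat[OF assms(2)]])
    with eq show "A \<noteq> B \<and> (\<exists>u v. A - B = outer m n u v)" by blast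
  next
    assume "A \<noteq> B \<and> (\<exists>u v. A - B = outer m n u v)"
    with eq obtain u v where "A - B = outer m n u v" "outer m n u v \<noteq> 0\<^sub>m m n" by auto
    then show "adjacent A B" by (simp add: adjacent_def mat_rank_outer)
  qed
qed

section \<open>Cliques of matrices of rank at most one\<close>

definition column_type :: "nat \<Rightarrow> nat \<Rightarrow> (nat \<Rightarrow> 'a::division_ring) \<Rightarrow> 'a mat \<Rightarrow> bool" where
  "column_type m n u M \<longleftrightarrow> (\<exists>v. M = outer m n u v)"

definition row_type :: "nat \<Rightarrow> nat \<Rightarrow> (nat \<Rightarrow> 'a::division_ring) \<Rightarrow> 'a mat \<Rightarrow> bool" where
  "row_type m n v M \<longleftrightarrow> (\<exists>u. M = outer m n u v)"

lemma outer_zero_left: "outer m n (\<lambda>_. 0) v = 0\<^sub>m m n"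
  by (intro eq_matI) (auto simp: outer_def)

lemma outer_zero_right: "outer m n u (\<lambda>_. 0) = 0\<^sub>m m n"
  by (intro eq_matI) (auto simp: outer_def)

lemma column_type_zero [simp]: "column_type m n u (0\<^sub>m m n)"
  unfolding column_type_def by (metis outer_zero_right)

lemma row_type_zero [simp]: "row_type m n v (0\<^sub>m m n)"
  unfolding row_type_def by (metis outer_zero_left)

lemma outer_cong:
  "(\<And>i j. i < m \<Longrightarrow> j < n \<Longrightarrow> u i * v j = u' i * v' j) \<Longrightarrow> outer m n u v = outer m n u' v'"
  by (intro eq_matI) (auto simp: outer_def)

lemma outer_nonzero:
  assumes "outer m n u v \<noteq> 0\<^sub>m m n"
  obtains i j where "i < m" "j < n" "u i \<noteq> 0" "v j \<noteq> 0"
proof -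
  have "\<exists>i<m. \<exists>j<n. u i \<noteq> 0 \<and> v j \<noteq> 0"
  proof (rule ccontr)
    assume "\<not> ?thesis"
    then have "outer m n u v = 0\<^sub>m m n" by (intro eq_matI) (auto simp: outer_def)
    with assms show False ..
  qed
  with that show thesis by blast
qed

text \<open>If \<open>v'\<close> is not a left multiple of \<open>v\<close>, a column operation that
  clears the first product shows \<open>x\<close> to be a right multiple of \<open>u'\<close>. Then
  \<open>u\<close> is one too, so \<open>u\<close> and \<open>u'\<close> span the same column
  space.\<close>

lemma outer_minus_outer_cases:
  assumes diff: "outer m n u v - outer m n u' v' = outer m n x y"
    and nz: "outer m n u v \<noteq> 0\<^sub>m m n"
  shows "column_type m n u (outer m n u' v') \<or> row_type m n v (outer m n u' v')"
proof (rule ccontr)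
  assume neg: "\<not> ?thesis"
  obtain p where p: "p < n" "v p \<noteq> 0"
    using nz by (rule outer_nonzero)
  have eq: "u i * v j - u' i * v' j = x i * y j" if "i < m" "j < n" for i j
    using arg_cong[OF diff, of "\<lambda>M. M $$ (i, j)"] that by (simp add: outer_def)
  \<comment> \<open>Otherwise \<open>v'\<close> is a left multiple of \<open>v\<close>; moving the
    factor into \<open>u'\<close> gives row type.\<close>
  have "\<exists>j<n. v' j \<noteq> v' p * inverse (v p) * v j"
  proof (rule ccontr)
    assume "\<not> ?thesis"
    then have "outer m n u' v' = outer m n (\<lambda>i. u' i * (v' p * inverse (v p))) v"
      by (intro outer_cong) (auto simp: mult.assoc)
    with neg show False by (auto simp: row_type_def)
  qed
  then obtain r where r: "r < n" "v' r \<noteq> v' p * inverse (v p) * v r" by blast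
  define d where "d = inverse (v p) * v r"
  define w where "w = v' r - v' p * d"
  define z where "z = y r - y p * d"
  have w: "w \<noteq> 0" using r by (simp add: w_def d_def mult.assoc)
  have vd: "v p * d = v r"
    using p by (simp add: d_def mult.assoc[symmetric])
  \<comment> \<open>The column operation \<open>column r - column p * d\<close> annihilates the first outer product.\<close>
  have uw: "u' i * w = - (x i * z)" if "i < m" for i
  proof -
    have "x i * z = x i * y r - x i * y p * d"
      by (simp add: z_def algebra_simps)
    also have "\<dots> = (u i * v r - u' i * v' r) - (u i * v p - u' i * v' p) * d"
      using eq[OF that p(1)] eq[OF that r(1)] by simp
    also have "\<dots> = (u i * v r - u i * (v p * d)) - u' i * w"
      by (simp add: w_def algebra_simps)
    finally show ?thesis by (simp add: vd)
  qed
  have "outer m n u' v' \<noteq> 0\<^sub>m m n"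
    using neg by auto
  then obtain i0 where i0: "i0 < m" "u' i0 \<noteq> 0" by (rule outer_nonzero)
  with uw[OF i0(1)] w have z: "z \<noteq> 0" by auto
  define c where "c = - (w * inverse z)"
  have xc: "x i = u' i * c" if "i < m" for i
  proof -
    have "x i = x i * z * inverse z" using z by (simp add: mult.assoc)
    also have "x i * z = - (u' i * w)" using uw[OF that] by simp
    finally show ?thesis by (simp add: c_def mult.assoc)
  qed
  \<comment> \<open>Found by solving the equation of column \<open>p\<close> for \<open>u i\<close>
    after substituting \<open>x i = u' i * c\<close>.\<close>
  define e where "e = (v' p + c * y p) * inverse (v p)"
  have ue: "u i = u' i * e" if "i < m" for i
  proof -
    have "u i * v p = u' i * (v' p + c * y p)"
      using eq[OF that p(1)] xc[OF that] by (simp add: algebra_simps)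
    then have "u i * v p * inverse (v p) = u' i * e"
      by (simp add: e_def mult.assoc)
    with p show ?thesis by (simp add: mult.assoc)
  qed
  obtain i1 where "i1 < m" "u i1 \<noteq> 0" using nz by (rule outer_nonzero)
  with ue[of i1] have e: "e \<noteq> 0" by auto
  have "outer m n u' v' = outer m n u (\<lambda>j. inverse e * v' j)"
  proof (rule outer_cong)
    fix i j assume "i < m" "j < n"
    have "u i * (inverse e * v' j) = u' i * (e * inverse e) * v' j"
      using ue[OF \<open>i < m\<close>] by (simp only: mult.assoc)
    with e show "u' i * v' j = u i * (inverse e * v' j)" by simp
  qed
  with neg show False by (auto simp: column_type_def)
qed

text \<open>Fix a nonzero member \<open>A\<close> with factors \<open>u\<close>, \<open>v\<close>.
  Each other member shares the column factor or the row factor with \<open>A\<close>; a member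
  \<open>B\<close> that fails the first alternative forces the second on all members.\<close>

lemma rank_le_1_clique_cases:
  assumes outer: "\<And>M. M \<in> S \<Longrightarrow> \<exists>u v. M = outer m n u v"
    and diff: "\<And>M Y. M \<in> S \<Longrightarrow> Y \<in> S \<Longrightarrow> \<exists>u v. M - Y = outer m n u v"
  shows "(\<exists>u. \<forall>M\<in>S. column_type m n u M) \<or> (\<exists>v. \<forall>M\<in>S. row_type m n v M)"
proof (cases "S \<subseteq> {0\<^sub>m m n}")
  case True
  then show ?thesis
    by (metis column_type_zero singletonD subsetD)
next
  case False
  then obtain A where A: "A \<in> S" "A \<noteq> 0\<^sub>m m n" by blast
  then obtain u v where Auv: "A = outer m n u v" using outer by blast
  show ?thesis
  proof (cases "\<forall>M\<in>S. column_type m n u M")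
    case False
    then obtain B where B: "B \<in> S" "\<not> column_type m n u B" by blast
    have "row_type m n v B"
      using outer_minus_outer_cases[of m n u v] diff[OF A(1) B(1)] outer[OF B(1)] A B Auv by blast
    then obtain w where Bw: "B = outer m n w v" by (auto simp: row_type_def)
    have Bnz: "B \<noteq> 0\<^sub>m m n"
      using B(2) by auto
    \<comment> \<open>A member \<open>G\<close> without the row factor \<open>v\<close> would share
      its column factor with both \<open>A\<close> and \<open>B\<close>. Then \<open>w\<close> is a
      right multiple of \<open>u\<close>, so \<open>B\<close> would be of column type after
      all.\<close>
    have "row_type m n v G" if G: "G \<in> S" for G
    proof (rule ccontr)
      assume nG: "\<not> row_type m n v G"
      have "column_type m n u G"
        using outer_minus_outer_cases[of m n u v] diff[OF A(1) G] outer[OF G] A Auv nG by blast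
      then obtain y where Gy: "G = outer m n u y" by (auto simp: column_type_def)
      have "column_type m n w G"
        using outer_minus_outer_cases[of m n w v] diff[OF B(1) G] outer[OF G] Bw Bnz nG by blast
      then obtain z where Gz: "G = outer m n w z" by (auto simp: column_type_def)
      have "G \<noteq> 0\<^sub>m m n"
        using nG by auto
      then obtain i j where ij: "i < m" "j < n" "w i \<noteq> 0" "z j \<noteq> 0"
        unfolding Gz by (rule outer_nonzero)
      have wu: "w k * z j = u k * y j" if "k < m" for k
        using Gy Gz that ij by (metis outer_index)
      define c where "c = y j * inverse (z j)"
      have wc: "w k = u k * c" if "k < m" for k
      proof -
        have "w k * z j * inverse (z j) = u k * c"
          using wu[OF that] by (simp add: c_def mult.assoc)
        with ij show ?thesis by (simp add: mult.assoc)
      qed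
      have "B = outer m n u (\<lambda>k. c * v k)"
        unfolding Bw by (rule outer_cong) (simp add: wc mult.assoc)
      with B(2) show False by (auto simp: column_type_def)
    qed
    then show ?thesis by blast
  qed blast
qed

text \<open>With one factor of the outer product fixed, \<open>M\<close> is determined by the first
  \<open>N\<close> values of the other factor.\<close>

lemma card_of_outer_family:
  fixes C :: "'a::ring_1 mat set" and F :: "(nat \<Rightarrow> 'a) \<Rightarrow> 'a mat"
  assumes C: "C \<subseteq> carrier_mat m n" and X0: "X0 \<in> carrier_mat m n"
    and f: "\<And>M. M \<in> C \<Longrightarrow> M - X0 = F (f M)"
    and F: "\<And>g h. (\<And>j. j < N \<Longrightarrow> g j = h j) \<Longrightarrow> F g = F h"
    and N: "N \<le> k"
  shows "|C| \<le>o |Func {..<k} (UNIV :: 'a set)|"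
proof (rule card_of_ordLeqI)
  \<comment> \<open>Members of \<open>Func\<close> take the value \<open>undefined\<close> outside
    their domain.\<close>
  let ?r = "\<lambda>M j. if j < k then f M j else undefined"
  show "inj_on ?r C"
  proof (rule inj_onI)
    fix M Y assume XY: "M \<in> C" "Y \<in> C" "?r M = ?r Y"
    then have "f M j = f Y j" if "j < N" for j
      using N that fun_cong[OF XY(3), of j] by simp
    then have "M - X0 = Y - X0" using f XY F by metis
    then have "M - X0 + X0 = Y - X0 + X0" by simp
    moreover have "Z - X0 + X0 = Z" if "Z \<in> carrier_mat m n" for Z
      by (rule eq_matI) (use that X0 in auto)
    ultimately show "M = Y" using XY(1,2) C by (metis subsetD)
  qed
  show "\<And>M. M \<in> C \<Longrightarrow> ?r M \<in> Func {..<k} UNIV"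
    by (simp add: Func_def)
qed

text \<open>Translation by a member \<open>X0\<close> turns the clique into a family of outer
  products with pairwise differences of rank at most one, so one factor can be held fixed.\<close>

lemma card_of_clique_le:
  fixes C :: "'a::division_ring mat set"
  assumes C: "C \<subseteq> carrier_mat m n"
    and clique: "\<And>M Y. M \<in> C \<Longrightarrow> Y \<in> C \<Longrightarrow> M \<noteq> Y \<Longrightarrow> adjacent M Y"
  shows "|C| \<le>o |Func {..<max m n} (UNIV :: 'a set)|"
proof (cases "C = {}")
  case True
  then show ?thesis by (simp add: card_of_empty)
next
  case False
  then obtain X0 where X0: "X0 \<in> C" by blast
  let ?S = "(\<lambda>M. M - X0) ` C"
  have outer: "\<exists>u v. M - Y = outer m n u v" if XY: "M \<in> C" "Y \<in> C" for M Y
  proof (cases "M = Y")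
    case True
    then have "M - Y = 0\<^sub>m m n" using XY C by auto
    then show ?thesis using outer_zero_left by metis
  next
    case False
    have "M \<in> carrier_mat m n" "Y \<in> carrier_mat m n" using XY C by auto
    then show ?thesis using clique[OF XY False] adjacent_iff_outer by metis
  qed
  have shift: "M - X0 - (Y - X0) = M - Y" if "M \<in> C" "Y \<in> C" for M Y
  proof (rule eq_matI)
    have carr: "M \<in> carrier_mat m n" "Y \<in> carrier_mat m n" "X0 \<in> carrier_mat m n"
      using that X0 C by auto
    then show "dim_row (M - X0 - (Y - X0)) = dim_row (M - Y)"
      "dim_col (M - X0 - (Y - X0)) = dim_col (M - Y)" by auto
    from carr show "(M - X0 - (Y - X0)) $$ (i, j) = (M - Y) $$ (i, j)"
      if "i < dim_row (M - Y)" "j < dim_col (M - Y)" for i j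
      using that by simp
  qed
  have "(\<exists>u. \<forall>M\<in>?S. column_type m n u M) \<or> (\<exists>v. \<forall>M\<in>?S. row_type m n v M)"
    by (rule rank_le_1_clique_cases) (use outer X0 shift in auto)
  then show ?thesis
  proof
    assume "\<exists>u. \<forall>M\<in>?S. column_type m n u M"
    then obtain u where "\<forall>M\<in>C. \<exists>v. M - X0 = outer m n u v"
      by (auto simp: column_type_def)
    then obtain f where f: "\<And>M. M \<in> C \<Longrightarrow> M - X0 = outer m n u (f M)"
      by (auto dest: bchoice)
    show ?thesis
      by (rule card_of_outer_family[OF C _ f, where N = n]) (use X0 C in \<open>auto intro: outer_cong\<close>)
  next
    assume "\<exists>v. \<forall>M\<in>?S. row_type m n v M"
    then obtain v where "\<forall>M\<in>C. \<exists>u. M - X0 = outer m n u v"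
      by (auto simp: row_type_def)
    then obtain f where f: "\<And>M. M \<in> C \<Longrightarrow> M - X0 = outer m n (f M) v"
      by (auto dest: bchoice)
    show ?thesis
      by (rule card_of_outer_family[where N = m and F = "\<lambda>g. outer m n g v", OF C _ f])
        (use X0 C in \<open>auto intro: outer_cong\<close>)
  qed
qed

text \<open>The free entries run along the longer side, in the first row or the first column, so
  that there are \<open>max m n\<close> of them.\<close>

definition line_mat :: "nat \<Rightarrow> nat \<Rightarrow> (nat \<Rightarrow> 'a::division_ring) \<Rightarrow> 'a mat" where
  "line_mat m n f = (if m \<le> n then outer m n (\<lambda>i. of_bool (i = 0)) f
                     else outer m n f (\<lambda>j. of_bool (j = 0)))"

lemma line_mat_carrier [simp]: "line_mat m n f \<in> carrier_mat m n"
  by (simp add: line_mat_def)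

lemma adjacent_line_mat:
  fixes f g :: "nat \<Rightarrow> 'a::division_ring"
  assumes "m \<ge> 1" "n \<ge> 1" and fg: "f \<in> Func {..<max m n} UNIV" "g \<in> Func {..<max m n} UNIV" "f \<noteq> g"
  shows "adjacent (line_mat m n f) (line_mat m n g)"
proof -
  obtain l where neq: "f l \<noteq> g l" using fg(3) by blast
  \<comment> \<open>Outside the domain both functions are \<open>undefined\<close>, so they must
    differ at a proper index.\<close>
  with fg(1,2) have l: "l < max m n" by (cases "l < max m n") (auto simp: Func_def)
  have "line_mat m n f \<noteq> line_mat m n g"
  proof
    assume eq: "line_mat m n f = line_mat m n g"
    have "f l = g l"
      using arg_cong[OF eq, of "\<lambda>M. M $$ (if m \<le> n then (0, l) else (l, 0))"] assms(1,2) l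
      by (auto simp: line_mat_def outer_def max_def split: if_splits)
    with neq show False by simp
  qed
  moreover have "line_mat m n f - line_mat m n g = line_mat m n (\<lambda>i. f i - g i)"
    by (rule eq_matI) (auto simp: line_mat_def outer_def algebra_simps)
  ultimately show ?thesis
    by (subst adjacent_iff_outer[of _ m n]) (auto simp: line_mat_def)
qed

section \<open>Homomorphisms, cliques and colourings\<close>

lemma cexp_UNIV_lessThan:
  "|UNIV :: 'a set| ^c |{..<s}| = |Func {..<s} (UNIV :: 'a set)|" for s :: nat
  by (simp add: cexp_def Field_card_of)

text \<open>Adjacent matrices are distinct, so the homomorphism is injective on the clique of all
  \<open>line_mat m n f\<close>, and its image is a clique of the target.\<close>

lemma graph_hom_imp_card_le:
  fixes \<phi> :: "'a::division_ring mat \<Rightarrow> 'b::division_ring mat"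
  assumes "m \<ge> 1" "n \<ge> 1" and hom: "graph_hom m n m' n' \<phi>"
  shows "|Func {..<max m n} (UNIV :: 'a set)| \<le>o |Func {..<max m' n'} (UNIV :: 'b set)|"
proof -
  let ?F = "Func {..<max m n} (UNIV :: 'a set)"
  let ?h = "\<lambda>f. \<phi> (line_mat m n f)"
  have carrier: "?h f \<in> carrier_mat m' n'" for f
    using hom by (auto simp: graph_hom_def)
  have adj: "adjacent (?h f) (?h g)" if "f \<in> ?F" "g \<in> ?F" "f \<noteq> g" for f g
    using hom adjacent_line_mat[OF assms(1,2) that] by (auto simp: graph_hom_def)
  have "inj_on ?h ?F"
    using adj adjacent_iff_outer[OF carrier carrier] by (meson inj_onI)
  then have "|?F| \<le>o |?h ` ?F|" by (rule card_of_ordLeqI) auto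
  also have "|?h ` ?F| \<le>o |Func {..<max m' n'} (UNIV :: 'b set)|"
    by (rule card_of_clique_le) (use carrier adj in auto)
  finally show ?thesis .
qed

text \<open>Any two distinct values of \<open>line_mat\<close> on \<open>Func\<close> are adjacent,
  so only the inequality of colours has to survive the map \<open>g\<close>.\<close>

lemma graph_hom_of_colouring:
  fixes col :: "'a::division_ring mat \<Rightarrow> 'c"
  assumes "m' \<ge> 1" "n' \<ge> 1"
    and col: "\<And>A B. A \<in> carrier_mat m n \<Longrightarrow> B \<in> carrier_mat m n \<Longrightarrow> adjacent A B \<Longrightarrow> col A \<noteq> col B"
    and card: "|col ` carrier_mat m n| \<le>o |Func {..<max m' n'} (UNIV :: 'b::division_ring set)|"
  shows "\<exists>\<phi> :: 'a mat \<Rightarrow> 'b mat. graph_hom m n m' n' \<phi>"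
proof -
  obtain g where g: "inj_on g (col ` carrier_mat m n)"
    "g ` col ` carrier_mat m n \<subseteq> Func {..<max m' n'} (UNIV :: 'b set)"
    using card card_of_ordLeq by metis
  have "graph_hom m n m' n' (\<lambda>A. line_mat m' n' (g (col A)))"
    unfolding graph_hom_def
  proof (intro conjI ballI impI)
    fix A B :: "'a mat" assume AB: "A \<in> carrier_mat m n" "B \<in> carrier_mat m n" "adjacent A B"
    then have "g (col A) \<noteq> g (col B)" using col g(1) by (simp add: inj_on_eq_iff)
    with AB g(2) show "adjacent (line_mat m' n' (g (col A))) (line_mat m' n' (g (col B)))"
      by (intro adjacent_line_mat assms) auto
  qed auto
  then show ?thesis by blast
qed

section \<open>Counting matrices over an infinite ring\<close>

lemma card_of_lists_length_infinite:
  assumes inf: "infinite (UNIV :: 'a set)"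
  shows "|{xs :: 'a list. length xs = N}| \<le>o |UNIV :: 'a set|"
proof (induction N)
  case 0
  show ?case by (rule card_of_ordLeqI[of "\<lambda>_. undefined"]) (auto simp: inj_on_def)
next
  case (Suc N)
  \<comment> \<open>A pairing function, available because an infinite set is equipotent to its
    square; it merges the head with the code of the tail.\<close>
  obtain f :: "'a \<times> 'a \<Rightarrow> 'a" where f: "inj f"
    using card_of_Times_same_infinite[OF inf] ordIso_imp_ordLeq card_of_ordLeq[of "UNIV \<times> UNIV"]
    by (metis UNIV_Times_UNIV)
  obtain g :: "'a list \<Rightarrow> 'a" where g: "inj_on g {xs. length xs = N}"
    using Suc by (auto simp flip: card_of_ordLeq)
  have "inj_on (\<lambda>xs. f (hd xs, g (tl xs))) {xs. length xs = Suc N}"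
  proof (rule inj_onI, clarify)
    fix xs ys :: "'a list"
    assume len: "length xs = Suc N" "length ys = Suc N" and "f (hd xs, g (tl xs)) = f (hd ys, g (tl ys))"
    then have "hd xs = hd ys" "g (tl xs) = g (tl ys)" using f by (auto dest: injD)
    moreover from this have "tl xs = tl ys" using g len by (auto dest: inj_onD)
    ultimately show "xs = ys" using len by (metis list.expand length_0_conv nat.distinct(1))
  qed
  then show ?case by (rule card_of_ordLeqI) auto
qed

lemma card_of_carrier_mat_infinite:
  assumes inf: "infinite (UNIV :: 'a set)"
  shows "|carrier_mat m n :: 'a mat set| \<le>o |UNIV :: 'a set|"
proof -
  \<comment> \<open>The entries in row-major order; entry \<open>(i, j)\<close> stands at position
    \<open>i * n + j\<close>.\<close>
  let ?l = "\<lambda>A :: 'a mat. map (\<lambda>k. A $$ (k div n, k mod n)) [0..<m * n]"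
  have "inj_on ?l (carrier_mat m n)"
  proof (rule inj_onI)
    fix A B :: "'a mat" assume AB: "A \<in> carrier_mat m n" "B \<in> carrier_mat m n" and eq: "?l A = ?l B"
    have "A $$ (i, j) = B $$ (i, j)" if ij: "i < m" "j < n" for i j
    proof -
      have "i * n + j < Suc i * n" using ij by simp
      also have "\<dots> \<le> m * n" using ij by (intro mult_le_mono1) simp
      finally have k: "i * n + j < m * n" .
      have "?l A ! (i * n + j) = ?l B ! (i * n + j)" by (simp only: eq)
      with k ij show ?thesis by simp
    qed
    with AB show "A = B" by (intro eq_matI) auto
  qed
  then have "|carrier_mat m n :: 'a mat set| \<le>o |{xs :: 'a list. length xs = m * n}|"
    by (rule card_of_ordLeqI) auto
  then show ?thesis using card_of_lists_length_infinite[OF inf] by (rule ordLeq_transitive)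
qed

text \<open>Constant functions give the injection, and the index 0 recovers the constant.\<close>

lemma card_of_UNIV_le_Func:
  assumes "(s :: nat) \<ge> 1"
  shows "|UNIV :: 'a set| \<le>o |Func {..<s} (UNIV :: 'a set)|"
proof (rule card_of_ordLeqI)
  show "inj_on (\<lambda>x i. if i < s then x else undefined) (UNIV :: 'a set)"
  proof (rule inj_onI)
    fix x y :: 'a
    assume eq: "(\<lambda>i. if i < s then x else undefined) = (\<lambda>i. if i < s then y else undefined)"
    show "x = y" using fun_cong[OF eq, of 0] assms by simp
  qed
qed (auto simp: Func_def)

lemma card_of_carrier_mat_infinite_le_Func:
  assumes inf: "infinite (UNIV :: 'a set)" and "max m n \<ge> 1"
  shows "|carrier_mat m n :: 'a mat set| \<le>o |Func {..<max m n} (UNIV :: 'a set)|"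
  using card_of_carrier_mat_infinite[OF inf] card_of_UNIV_le_Func[OF assms(2)]
  by (rule ordLeq_transitive)

section \<open>Left vector spaces over finite division rings\<close>

definition subdivision_ring :: "'a::division_ring set \<Rightarrow> bool" where
  "subdivision_ring K \<longleftrightarrow> 1 \<in> K \<and> (\<forall>x\<in>K. \<forall>y\<in>K. x - y \<in> K \<and> x * y \<in> K) \<and> (\<forall>x\<in>K. inverse x \<in> K)"

lemma subdivision_ringD:
  assumes "subdivision_ring K"
  shows "1 \<in> K" "0 \<in> K" "x \<in> K \<Longrightarrow> y \<in> K \<Longrightarrow> x - y \<in> K" "x \<in> K \<Longrightarrow> y \<in> K \<Longrightarrow> x + y \<in> K"
    "x \<in> K \<Longrightarrow> y \<in> K \<Longrightarrow> x * y \<in> K" "x \<in> K \<Longrightarrow> - x \<in> K" "x \<in> K \<Longrightarrow> inverse x \<in> K"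
proof -
  show one: "1 \<in> K" and diff: "\<And>x y. x \<in> K \<Longrightarrow> y \<in> K \<Longrightarrow> x - y \<in> K"
    and "x \<in> K \<Longrightarrow> y \<in> K \<Longrightarrow> x * y \<in> K" "x \<in> K \<Longrightarrow> inverse x \<in> K"
    using assms by (auto simp: subdivision_ring_def)
  show zero: "0 \<in> K" using diff[OF one one] by simp
  show minus: "- x \<in> K" if "x \<in> K" for x using diff[OF zero that] by simp
  show "x + y \<in> K" if "x \<in> K" "y \<in> K" using diff[OF that(1) minus[OF that(2)]] by simp
qed

definition left_independent :: "'a::division_ring set \<Rightarrow> nat \<Rightarrow> (nat \<Rightarrow> 'a) \<Rightarrow> bool" where
  "left_independent K t b \<longleftrightarrow>
     (\<forall>c. (\<forall>i<t. c i \<in> K) \<longrightarrow> (\<Sum>i<t. c i * b i) = 0 \<longrightarrow> (\<forall>i<t. c i = 0))"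

lemma left_independentD:
  "left_independent K t b \<Longrightarrow> (\<And>i. i < t \<Longrightarrow> c i \<in> K) \<Longrightarrow> (\<Sum>i<t. c i * b i) = 0 \<Longrightarrow> i < t \<Longrightarrow> c i = 0"
  by (auto simp: left_independent_def)

text \<open>Extensional coefficient functions represent each coefficient tuple exactly once, so the
  tuples number \<open>card K ^ t\<close>.\<close>

definition left_combs :: "'a::division_ring set \<Rightarrow> nat \<Rightarrow> (nat \<Rightarrow> 'a) \<Rightarrow> 'a set" where
  "left_combs K t b = (\<lambda>c. \<Sum>i<t. c i * b i) ` PiE {..<t} (\<lambda>_. K)"

lemma left_combsI:
  assumes "\<And>i. i < t \<Longrightarrow> c i \<in> K"
  shows "(\<Sum>i<t. c i * b i) \<in> left_combs K t b"
  unfolding left_combs_def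
  by (rule image_eqI[where x = "restrict c {..<t}"]) (use assms in auto)

lemma card_left_combs:
  assumes K: "subdivision_ring K" and ind: "left_independent K t b"
  shows "card (left_combs K t b) = card K ^ t"
proof -
  have "inj_on (\<lambda>c. \<Sum>i<t. c i * b i) (PiE {..<t} (\<lambda>_. K))"
  proof (rule inj_onI)
    fix c d assume cd: "c \<in> PiE {..<t} (\<lambda>_. K)" "d \<in> PiE {..<t} (\<lambda>_. K)"
      and eq: "(\<Sum>i<t. c i * b i) = (\<Sum>i<t. d i * b i)"
    have "(\<Sum>i<t. (c i - d i) * b i) = 0"
      using eq by (simp add: left_diff_distrib sum_subtractf)
    moreover have "c i - d i \<in> K" if "i < t" for i
      using that cd by (intro subdivision_ringD[OF K]) auto
    ultimately have "c i - d i = 0" if "i < t" for i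
      using left_independentD[OF ind, of "\<lambda>i. c i - d i"] that by blast
    then show "c = d" by (intro PiE_ext[OF cd]) auto
  qed
  then show ?thesis
    by (simp add: left_combs_def card_image card_PiE)
qed

text \<open>An independent family of greatest length spans \<open>V\<close>. It shows that the size
  of a finite left space over \<open>K\<close> is a power of \<open>card K\<close>, which is how
  both dimension counts below are obtained.\<close>

lemma left_basis_exists:
  assumes K: "subdivision_ring K" and finK: "finite K" and finV: "finite V"
    and V: "0 \<in> V" "\<And>x y. x \<in> V \<Longrightarrow> y \<in> V \<Longrightarrow> x + y \<in> V" "\<And>c x. c \<in> K \<Longrightarrow> x \<in> V \<Longrightarrow> c * x \<in> V"
  obtains t b where "\<And>i. i < t \<Longrightarrow> b i \<in> V" "left_independent K t b" "card V = card K ^ t"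
proof -
  define P where "P t \<longleftrightarrow> (\<exists>b. (\<forall>i<t. b i \<in> V) \<and> left_independent K t b)" for t
  have sumV: "(\<Sum>i<t. c i * b i) \<in> V" if "\<And>i. i < t \<Longrightarrow> c i \<in> K" "\<And>i. i < t \<Longrightarrow> b i \<in> V" for t :: nat and c b
    using that by (induction t) (auto intro: V)
  have combsV: "left_combs K t b \<subseteq> V" if "\<forall>i<t. b i \<in> V" for t b
    using that by (auto simp: left_combs_def intro!: sumV)
  have K2: "2 \<le> card K"
    using card_mono[OF finK, of "{0, 1}"] subdivision_ringD(1,2)[OF K] by auto
  have bound: "t \<le> card V" if "P t" for t
  proof -
    obtain b where b: "\<forall>i<t. b i \<in> V" "left_independent K t b" using \<open>P t\<close> by (auto simp: P_def)
    \<comment> \<open>Distinct combinations bound the length of independent families, so that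
      \<open>Greatest\<close> is meaningful.\<close>
    have "t < 2 ^ t" by (rule less_exp)
    also have "2 ^ t \<le> card K ^ t" using K2 by (rule power_mono) simp
    also have "\<dots> = card (left_combs K t b)" using card_left_combs[OF K b(2)] by simp
    also have "\<dots> \<le> card V" by (rule card_mono[OF finV combsV[OF b(1)]])
    finally show ?thesis by simp
  qed
  have "P 0" by (simp add: P_def left_independent_def)
  define t where "t = Greatest P"
  have Pt: "P t" unfolding t_def using GreatestI_nat[of P 0] \<open>P 0\<close> bound by blast
  have maximal: "s \<le> t" if "P s" for s
    unfolding t_def using Greatest_le_nat[of P s] that bound by blast
  obtain b where b: "\<forall>i<t. b i \<in> V" "left_independent K t b" using Pt by (auto simp: P_def)
  have "V \<subseteq> left_combs K t b"
  proof
    fix x assume x: "x \<in> V"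
    show "x \<in> left_combs K t b"
    proof (rule ccontr)
      assume notin: "x \<notin> left_combs K t b"
      let ?b = "b(t := x)"
      have "left_independent K (Suc t) ?b"
        unfolding left_independent_def
      proof (intro allI impI)
        fix c i assume c: "\<forall>i<Suc t. c i \<in> K" and eq: "(\<Sum>i<Suc t. c i * ?b i) = 0" and i: "i < Suc t"
        have eq': "(\<Sum>i<t. c i * b i) + c t * x = 0" using eq by simp
        \<comment> \<open>Otherwise the relation could be solved for \<open>x\<close>, making it a
          combination of the old vectors.\<close>
        have ct: "c t = 0"
        proof (rule ccontr)
          assume nz: "c t \<noteq> 0"
          have "c t * x = - (\<Sum>i<t. c i * b i)"
            using eq' by (simp add: eq_neg_iff_add_eq_0 add.commute)
          then have "inverse (c t) * (c t * x) = inverse (c t) * - (\<Sum>i<t. c i * b i)" by simp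
          then have "x = (\<Sum>i<t. - (inverse (c t) * c i) * b i)"
            using nz by (simp add: mult.assoc[symmetric] sum_distrib_left sum_negf)
          moreover have "(\<Sum>i<t. - (inverse (c t) * c i) * b i) \<in> left_combs K t b"
            by (rule left_combsI) (use c in \<open>auto intro!: subdivision_ringD[OF K]\<close>)
          ultimately show False using notin by simp
        qed
        with eq' have "(\<Sum>i<t. c i * b i) = 0" by simp
        with c b(2) have "\<forall>i<t. c i = 0" by (auto simp: left_independent_def)
        with ct i show "c i = 0" by (auto simp: less_Suc_eq)
      qed
      then have "P (Suc t)" using b(1) x by (auto simp: P_def less_Suc_eq intro!: exI[of _ ?b])
      with maximal show False by fastforce
    qed
  qed
  with combsV[OF b(1)] have "V = left_combs K t b" by blast
  with card_left_combs[OF K b(2)] b show thesis using that by blast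
qed

section \<open>Wedderburn's theorem\<close>

lemma map_poly_of_int_mult:
  "map_poly (of_int :: int \<Rightarrow> complex) (p * q) = map_poly of_int p * map_poly of_int q"
  by (rule poly_eqI) (simp add: coeff_map_poly coeff_mult)

lemma poly_map_poly_of_int:
  "poly (map_poly (of_int :: int \<Rightarrow> complex) p) (of_int x) = of_int (poly p x)"
  by (induction p) (simp_all add: map_poly_pCons)

text \<open>A root of a product is a root of one factor, and units have no roots, so induction over
  the prime factorization reaches a suitable factor.\<close>

lemma prime_factor_with_root:
  fixes p :: "int poly" and z :: complex
  assumes "p \<noteq> 0" "poly (map_poly of_int p) z = 0"
  shows "\<exists>P. prime P \<and> P dvd p \<and> poly (map_poly of_int P) z = 0"
  using assms
proof (induction p rule: prime_divisors_induct)
  case (unit p)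
  then obtain c where "p = [:c:]" "c dvd 1" by (auto simp: is_unit_poly_iff)
  with unit show ?case by (auto simp: map_poly_pCons)
next
  case (factor P p)
  then show ?case by (auto simp: map_poly_of_int_mult intro: dvd_mult)
qed simp

text \<open>Split \<open>p\<close> into linear factors. One of them exceeds \<open>r\<close>
  strictly; the others and the leading coefficient have norm at least 1.\<close>

lemma norm_poly_gt_of_roots:
  fixes p :: "complex poly"
  assumes deg: "degree p > 0" and lc: "norm (lead_coeff p) \<ge> 1" and r: "r \<ge> 1"
    and roots: "\<And>z. poly p z = 0 \<Longrightarrow> norm (x - z) > r"
  shows "norm (poly p x) > r"
proof -
  have p0: "p \<noteq> 0" using deg by auto
  have ne: "proots p \<noteq> {#}"
  proof -
    obtain z where "poly p z = 0" using deg alg_closed_imp_poly_has_root by blast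
    then have "z \<in># proots p" using p0 by simp
    then show ?thesis by auto
  qed
  have prod1: "norm (\<Prod>z\<in>#A. x - z) \<ge> 1" if "\<And>z. z \<in># A \<Longrightarrow> norm (x - z) > r" for A
    using that
  proof (induction A)
    case (add z A)
    have "1 \<le> norm (x - z)" using add.prems[of z] r by simp
    moreover have "1 \<le> norm (\<Prod>z\<in>#A. x - z)" using add by simp
    ultimately have "1 * 1 \<le> norm (x - z) * norm (\<Prod>z\<in>#A. x - z)" by (intro mult_mono) auto
    then show ?case by (simp add: norm_mult)
  qed simp
  obtain z A where A: "proots p = add_mset z A" using ne by (meson multiset_cases)
  have root: "norm (x - w) > r" if "w \<in># proots p" for w using that p0 roots by simp
  have "poly (\<Prod>z\<in>#B. [:-z, 1:]) x = (\<Prod>z\<in>#B. x - z)" for B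
    by (induction B) (auto simp: algebra_simps)
  then have "poly p x = lead_coeff p * (\<Prod>z\<in>#proots p. x - z)"
    by (metis complex_poly_decompose_multiset poly_smult)
  then have eq: "norm (poly p x) = norm (lead_coeff p) * (norm (x - z) * norm (\<Prod>z\<in>#A. x - z))"
    by (simp add: A norm_mult)
  have "r < norm (x - z)" using root A by simp
  also have "\<dots> = 1 * (norm (x - z) * 1)" by simp
  also have "\<dots> \<le> norm (poly p x)" unfolding eq
    by (intro mult_mono lc prod1 root) (auto simp: A)
  finally show ?thesis .
qed

text \<open>A point of the unit circle other than 1 has real part strictly below 1; comparing real
  parts suffices.\<close>

lemma norm_diff_root_of_unity:
  fixes z :: complex and x :: real
  assumes z: "norm z = 1" "z \<noteq> 1" and x: "x > 1"
  shows "norm (of_real x - z) > x - 1"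
proof -
  have re: "Re z < 1"
  proof (rule ccontr)
    assume "\<not> Re z < 1"
    moreover have "Re z \<le> 1" using complex_Re_le_cmod[of z] z by simp
    ultimately have "Re z = 1" by simp
    with z(1) have "Im z = 0" by (simp add: cmod_def)
    with \<open>Re z = 1\<close> z(2) show False by (simp add: complex_eq_iff)
  qed
  have "x - 1 < Re (of_real x - z)" using re by simp
  also have "\<dots> \<le> norm (of_real x - z)" by (rule complex_Re_le_cmod)
  finally show ?thesis .
qed

lemma X_power_minus_1_nonzero: "n > 0 \<Longrightarrow> monom 1 n - 1 \<noteq> (0 :: 'a::comm_ring_1 poly)"
proof
  assume n: "n > 0" and "monom 1 n - 1 = (0 :: 'a poly)"
  then have "coeff (monom 1 n - 1 :: 'a poly) n = 0" by simp
  with n show False by (simp add: coeff_1)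
qed

lemma poly_X_power_minus_1: "poly (monom 1 n - 1) x = x ^ n - (1 :: 'a::comm_ring_1)"
  by (simp add: poly_monom)

lemma power_minus_1_dvd_poly:
  "d dvd n \<Longrightarrow> monom 1 d - 1 dvd (monom 1 n - 1 :: 'a::comm_ring_1 poly)"
proof (elim dvdE)
  fix k assume "n = d * k"
  then have "(monom 1 n :: 'a poly) = monom 1 d ^ k" by (simp add: monom_power)
  then show ?thesis using power_diff_1_eq[of "monom 1 d :: 'a poly" k] by simp
qed

text \<open>
  Only a factor of the \<open>n\<close>-th cyclotomic polynomial is needed, so irreducibility of that
  polynomial plays no role: any prime factor of \<open>X ^ n - 1\<close> vanishing at a primitive
  \<open>n\<close>-th root of unity will do.
\<close>

lemma cyclotomic_factor:
  assumes n: "n \<ge> 2"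
  obtains P :: "int poly" where "P dvd monom 1 n - 1"
    "\<And>d. 0 < d \<Longrightarrow> d < n \<Longrightarrow> d dvd n \<Longrightarrow> (monom 1 d - 1) * P dvd monom 1 n - 1"
    "\<And>q :: int. q \<ge> 2 \<Longrightarrow> \<bar>poly P q\<bar> > q - 1"
proof -
  let ?f = "of_int :: int \<Rightarrow> complex"
  let ?X = "\<lambda>n. monom 1 n - 1 :: int poly"
  \<comment> \<open>A primitive \<open>n\<close>-th root of unity.\<close>
  define z where "z = cis (2 * pi / n)"
  have map_X: "poly (map_poly ?f (?X d)) w = w ^ d - 1" for d w
  proof -
    have "map_poly ?f (?X d) = monom 1 d - 1"
      by (rule poly_eqI) (simp add: coeff_map_poly)
    then show ?thesis by (simp add: poly_monom)
  qed
  have zn: "z ^ n = 1" using n by (simp add: z_def DeMoivre)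
  have zd: "z ^ d \<noteq> 1" if d: "0 < d" "d < n" for d
  proof
    assume "z ^ d = 1"
    then have eq: "cis (2 * pi * real d / real n) = cis (2 * pi * real 0 / real n)"
      by (simp add: z_def DeMoivre mult_ac)
    have inj: "inj_on (\<lambda>k. cis (2 * pi * real k / real n)) {..<n}"
      using bij_betw_roots_unity[of n] n by (auto simp: bij_betw_def)
    have "d = 0" by (rule inj_onD[OF inj eq]) (use d in auto)
    with d show False by simp
  qed
  obtain P where P: "prime P" "P dvd ?X n" "poly (map_poly ?f P) z = 0"
    using prime_factor_with_root[of "?X n" z] X_power_minus_1_nonzero[of n] map_X zn n by auto
  \<comment> \<open>Since \<open>z\<close> is a root of \<open>P\<close> but not of
    \<open>?X d\<close>, the prime \<open>P\<close> must divide the cofactor.\<close>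
  have dvd: "\<exists>g. ?X n = ?X d * g \<and> P dvd g" if d: "0 < d" "d < n" "d dvd n" for d
  proof -
    obtain g where g: "?X n = ?X d * g" using power_minus_1_dvd_poly[OF d(3)] by (elim dvdE)
    have "\<not> P dvd ?X d"
    proof
      assume "P dvd ?X d"
      then have "poly (map_poly ?f (?X d)) z = 0"
        using P(3) by (auto elim!: dvdE simp: map_poly_of_int_mult)
      with map_X zd[OF d(1,2)] show False by simp
    qed
    with P(1,2) g have "P dvd g" by (simp add: prime_dvd_mult_iff)
    with g show ?thesis by blast
  qed
  show thesis
  proof
    show "P dvd ?X n" by (rule P)
    show "?X d * P dvd ?X n" if "0 < d" "d < n" "d dvd n" for d
      using dvd[OF that] by (auto intro: mult_dvd_mono)
    show "\<bar>poly P q\<bar> > q - 1" if q: "q \<ge> 2" for q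
    proof -
      obtain h where h: "?X n = P * h" using P(2) by (elim dvdE)
      have P0: "P \<noteq> 0" using P(1) by auto
      have lc: "lead_coeff (map_poly ?f P) = of_int (lead_coeff P)"
        by (simp add: coeff_map_poly degree_map_poly)
      have degeq: "degree (map_poly ?f P) = degree P" by (simp add: degree_map_poly)
      have deg: "degree (map_poly ?f P) > 0"
      proof (rule ccontr)
        assume "\<not> ?thesis"
        then obtain c where "P = [:c:]" using degeq by (auto elim: degree_eq_zeroE)
        with P(3) P0 show False by (simp add: map_poly_pCons)
      qed
      have "norm (poly (map_poly ?f P) (of_int q)) > real_of_int q - 1"
      proof (rule norm_poly_gt_of_roots[OF deg])
        show "norm (lead_coeff (map_poly ?f P)) \<ge> 1"
        proof -
          have "\<bar>lead_coeff P\<bar> \<ge> 1" using P0 by (simp add: int_one_le_iff_zero_less)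
          then show ?thesis unfolding lc norm_of_int by linarith
        qed
        show "real_of_int q - 1 \<ge> 1" using q by simp
        fix w assume w: "poly (map_poly ?f P) w = 0"
        have "w ^ n - 1 = 0" using w map_X[of n w] by (simp add: h map_poly_of_int_mult)
        then have norm: "norm w = 1" using n power_eq_1_iff[of w n] by auto
        \<comment> \<open>\<open>P\<close> divides the cofactor of \<open>?X 1\<close>, which is the
          geometric sum and takes the value \<open>n\<close> at 1.\<close>
        have "w \<noteq> 1"
        proof
          assume w1: "w = 1"
          obtain g where g: "?X n = ?X 1 * g" "P dvd g" using dvd[of 1] n by auto
          have "?X n = ?X 1 * (\<Sum>i<n. monom 1 1 ^ i)"
            using power_diff_1_eq[of "monom 1 1 :: int poly" n] by (simp add: monom_power)
          then have "?X 1 * g = ?X 1 * (\<Sum>i<n. monom 1 1 ^ i)" using g(1) by argo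
          then have "g = (\<Sum>i<n. monom 1 1 ^ i)"
            using X_power_minus_1_nonzero[of 1, where ?'a = int] by simp
          then have "poly g 1 = int n" by (simp add: poly_sum poly_monom)
          moreover have "poly (map_poly ?f g) 1 = 0"
            using g(2) w w1 by (auto elim!: dvdE simp: map_poly_of_int_mult)
          ultimately show False using poly_map_poly_of_int[of g 1] n by simp
        qed
        with norm_diff_root_of_unity[OF norm, of "of_int q"] q
        show "norm (of_int q - w) > real_of_int q - 1" by simp
      qed
      then have "real_of_int \<bar>poly P q\<bar> > real_of_int (q - 1)"
        unfolding poly_map_poly_of_int norm_of_int by simp
      then show ?thesis by (simp only: of_int_less_iff)
    qed
  qed
qed

section \<open>Centralizers and conjugacy classes\<close>

definition centralizer :: "'a::division_ring set \<Rightarrow> 'a set" where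
  "centralizer A = {y. \<forall>x\<in>A. x * y = y * x}"

lemma subdivision_ring_centralizer: "subdivision_ring (centralizer A)"
  unfolding subdivision_ring_def
proof (intro conjI ballI)
  fix x y assume "x \<in> centralizer A" "y \<in> centralizer A"
  then have "a * x = x * a" "a * y = y * a" if "a \<in> A" for a
    using that by (auto simp: centralizer_def)
  then have "a * (x * y) = x * y * a" "a * (x - y) = (x - y) * a" if "a \<in> A" for a
    using that by (metis mult.assoc, simp add: right_diff_distrib left_diff_distrib)
  then show "x - y \<in> centralizer A" "x * y \<in> centralizer A" by (auto simp: centralizer_def)
next
  fix x assume "x \<in> centralizer A"
  then show "inverse x \<in> centralizer A"
    by (auto simp: centralizer_def intro: mult_commute_imp_mult_inverse_commute[symmetric])
qed (simp add: centralizer_def)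

text \<open>Modulo \<open>q ^ d - 1\<close> the number \<open>q ^ n - 1\<close> reduces to
  \<open>q ^ r - 1\<close> with \<open>r = n mod d\<close>, which is too small to be a nonzero
  multiple.\<close>

lemma power_minus_1_dvd_imp_dvd:
  fixes q :: int
  assumes q: "q \<ge> 2" and d: "d \<ge> 1" and dvd: "q ^ d - 1 dvd q ^ n - 1"
  shows "d dvd n"
proof -
  define r where "r = n mod d"
  have r: "r < d" using d by (simp add: r_def)
  have "q ^ n = (q ^ d) ^ (n div d) * q ^ r"
    by (simp add: r_def flip: power_mult power_add)
  then have "q ^ n - 1 = ((q ^ d) ^ (n div d) - 1) * q ^ r + (q ^ r - 1)"
    by (simp add: algebra_simps)
  moreover have "q ^ d - 1 dvd (q ^ d) ^ (n div d) - 1"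
    using power_diff_1_eq[of "q ^ d" "n div d"] by simp
  ultimately have "q ^ d - 1 dvd q ^ r - 1"
    using dvd by (metis dvd_add_right_iff dvd_mult2)
  moreover have "q ^ r - 1 < q ^ d - 1"
    using r q by (simp add: power_strict_increasing)
  moreover have "0 \<le> q ^ r - 1" using q by simp
  ultimately have "q ^ r - 1 = 0" 
    using zdvd_not_zless[of "q ^ r - 1" "q ^ d - 1"] by (cases "q ^ r - 1 = 0") auto
  then have "r = 0" using q by (cases r) (auto simp: zmult_eq_1_iff)
  then show ?thesis by (simp add: r_def mod_eq_0_iff_dvd)
qed

definition conj_class :: "'a::division_ring \<Rightarrow> 'a set" where
  "conj_class x = (\<lambda>g. g * x * inverse g) ` (- {0})"

lemma conj_class_self: "x \<in> conj_class x"
  unfolding conj_class_def by (rule image_eqI[of _ _ 1]) auto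

lemma conj_class_subset:
  assumes "y \<in> conj_class x"
  shows "conj_class y \<subseteq> conj_class x"
proof
  fix z assume "z \<in> conj_class y"
  with assms obtain g h where "g \<noteq> 0" "h \<noteq> 0" "z = h * (g * x * inverse g) * inverse h"
    by (auto simp: conj_class_def)
  then have "z = (h * g) * x * inverse (h * g)" "h * g \<noteq> 0"
    by (auto simp: nonzero_inverse_mult_distrib mult.assoc)
  then show "z \<in> conj_class x" by (auto simp: conj_class_def)
qed

lemma conj_class_sym:
  assumes "y \<in> conj_class x"
  shows "x \<in> conj_class y"
proof -
  obtain g where g: "g \<noteq> 0" "y = g * x * inverse g" using assms by (auto simp: conj_class_def)
  then have "x = inverse g * y * inverse (inverse g)"
    by (simp add: mult.assoc) (simp add: mult.assoc[symmetric])
  with g show ?thesis unfolding conj_class_def by (intro image_eqI[of _ _ "inverse g"]) auto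
qed

text \<open>Orbit-stabilizer count: the fibres of conjugation \<open>g * x * inverse g\<close> are
  left cosets of the unit group of the centralizer.\<close>

lemma card_conj_class:
  fixes x :: "'a::division_ring"
  assumes fin: "finite (UNIV :: 'a set)"
  shows "card (UNIV :: 'a set) - 1 = card (conj_class x) * (card (centralizer {x}) - 1)"
proof -
  let ?U = "- {0 :: 'a}" and ?f = "\<lambda>g. g * x * inverse g"
  have finS: "finite S" for S :: "'a set" using fin by (rule finite_subset[rotated]) simp
  have fiber: "card {g \<in> ?U. ?f g = y} = card (centralizer {x}) - 1" if "y \<in> ?f ` ?U" for y
  proof -
    from that obtain h where h: "h \<noteq> 0" "y = ?f h" by auto
    have "{g \<in> ?U. ?f g = y} = (\<lambda>c. h * c) ` (centralizer {x} - {0})"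
    proof (intro equalityI subsetI)
      fix g assume "g \<in> {g \<in> ?U. ?f g = y}"
      then have g: "g \<noteq> 0" "g * x * inverse g = h * x * inverse h" using h by auto
      define c where "c = inverse h * g"
      have "g * x = g * x * inverse g * g" using g(1) by (simp add: mult.assoc)
      then have "inverse h * (g * x) = inverse h * (h * x * inverse h * g)" by (simp only: g(2))
      then have "c * x = x * c" using h by (simp add: c_def mult.assoc[symmetric])
      moreover have "g = h * c" using h by (simp add: c_def mult.assoc[symmetric])
      moreover have "c \<noteq> 0" using g h by (simp add: c_def)
      ultimately show "g \<in> (\<lambda>c. h * c) ` (centralizer {x} - {0})"
        by (auto simp: centralizer_def)
    next
      fix g assume "g \<in> (\<lambda>c. h * c) ` (centralizer {x} - {0})"
      then obtain c where c: "c \<noteq> 0" "x * c = c * x" "g = h * c" by (auto simp: centralizer_def)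
      have "g * x * inverse g = h * (c * x) * (inverse c * inverse h)"
        using c h by (simp add: nonzero_inverse_mult_distrib mult.assoc)
      also have "\<dots> = h * x * (c * inverse c) * inverse h"
        by (simp only: c(2)[symmetric] mult.assoc)
      finally show "g \<in> {g \<in> ?U. ?f g = y}" using c h by simp
    qed
    moreover have "inj_on (\<lambda>c. h * c) (centralizer {x} - {0})" using h by (auto simp: inj_on_def)
    moreover have "0 \<in> centralizer {x}" by (simp add: centralizer_def)
    ultimately show ?thesis by (simp add: card_image finS)
  qed
  have "card (UNIV :: 'a set) - 1 = card ?U" by (simp add: Compl_eq_Diff_UNIV finS)
  also have "\<dots> = (\<Sum>g\<in>?U. 1)" by simp
  also have "\<dots> = (\<Sum>y\<in>?f ` ?U. \<Sum>g\<in>{g \<in> ?U. ?f g = y}. 1)" by (rule sum.image_gen[OF finS])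
  also have "\<dots> = (\<Sum>y\<in>?f ` ?U. card (centralizer {x}) - 1)"
    by (rule sum.cong[OF refl]) (simp only: fiber[symmetric] sum_constant mult_1_right of_nat_id)
  also have "\<dots> = card (conj_class x) * (card (centralizer {x}) - 1)"
    by (simp add: conj_class_def)
  finally show ?thesis .
qed

text \<open>Witt's argument by the class equation. The value \<open>N\<close> of the cyclotomic
  factor at \<open>q\<close> divides \<open>q ^ n - 1\<close> and the size of every noncentral
  class, hence also \<open>q - 1\<close>, against its lower bound.\<close>

theorem wedderburn:
  fixes x y :: "'a::division_ring"
  assumes fin: "finite (UNIV :: 'a set)"
  shows "x * y = y * x"
proof (rule ccontr)
  assume noncomm: "x * y \<noteq> y * x"
  define Z where "Z = (centralizer UNIV :: 'a set)"
  define q where "q = card Z"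
  have finS: "finite S" for S :: "'a set" using fin by (rule finite_subset[rotated]) simp
  have Z: "subdivision_ring Z" by (simp add: Z_def subdivision_ring_centralizer)
  have ZUNIV: "Z \<noteq> UNIV" using noncomm by (auto simp: Z_def centralizer_def)
  have two: "2 \<le> card K" if "subdivision_ring K" for K :: "'a set"
    using card_mono[OF finS[of K], of "{0, 1}"] subdivision_ringD(1,2)[OF that] by auto
  have q2: "2 \<le> q" using two[OF Z] by (simp add: q_def)
  \<comment> \<open>Every division ring between the centre and the whole ring is a left space over
    the centre.\<close>
  have dim: "\<exists>d. card K = q ^ d" if K: "subdivision_ring K" "Z \<subseteq> K" for K
    by (rule left_basis_exists[OF Z finS finS, of K])
      (use K in \<open>auto simp: q_def intro: subdivision_ringD[OF K(1)]\<close>)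
  obtain n where n: "card (UNIV :: 'a set) = q ^ n"
    using dim[of UNIV] by (auto simp: subdivision_ring_def)
  have n2: "n \<ge> 2"
  proof (rule ccontr)
    assume "\<not> n \<ge> 2"
    then consider "n = 0" | "n = 1" by linarith
    then show False
    proof cases
      case 1
      then show False using n two[of UNIV] by (simp add: subdivision_ring_def)
    next
      case 2
      then have "Z = UNIV" using n by (intro card_subset_eq finS) (auto simp: q_def)
      with ZUNIV show False ..
    qed
  qed
  have qn: "int (card (UNIV :: 'a set) - 1) = int q ^ n - 1" using n q2 by (simp add: of_nat_diff)
  obtain P :: "int poly" where P: "P dvd monom 1 n - 1"
    "\<And>d. 0 < d \<Longrightarrow> d < n \<Longrightarrow> d dvd n \<Longrightarrow> (monom 1 d - 1) * P dvd monom 1 n - 1"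
    "\<And>q :: int. q \<ge> 2 \<Longrightarrow> \<bar>poly P q\<bar> > q - 1"
    using cyclotomic_factor[OF n2] by metis
  define N where "N = poly P (int q)"
  have N1: "N dvd int q ^ n - 1"
  proof -
    obtain h where "monom 1 n - 1 = P * h" using P(1) by (rule dvdE)
    from arg_cong[OF this, of "\<lambda>p. poly p (int q)"] show ?thesis
      by (simp only: poly_mult poly_X_power_minus_1 N_def dvd_triv_left)
  qed
  have class_dvd: "nat \<bar>N\<bar> dvd card (conj_class a)" if a: "a \<notin> Z" for a
  proof -
    have "Z \<subseteq> centralizer {a}" by (auto simp: Z_def centralizer_def)
    then obtain d where d: "card (centralizer {a}) = q ^ d"
      using dim subdivision_ring_centralizer by metis
    have eq: "int q ^ n - 1 = int (card (conj_class a)) * (int q ^ d - 1)"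
      using arg_cong[OF card_conj_class[OF fin, of a], of int] q2
      unfolding qn by (simp add: d of_nat_diff)
    have d0: "d \<ge> 1"
      using two[OF subdivision_ring_centralizer, of "{a}"] d by (cases d) auto
    obtain b where "b * a \<noteq> a * b" using a by (auto simp: Z_def centralizer_def)
    then have "b \<notin> centralizer {a}" by (auto simp: centralizer_def)
    then have "centralizer {a} \<subset> UNIV" by blast
    then have "q ^ d < q ^ n" using psubset_card_mono[OF finS[of UNIV]] d n by metis
    then have dn: "d < n" using q2 by (simp add: power_strict_increasing_iff)
    \<comment> \<open>The class size \<open>eq\<close> exhibits \<open>q ^ d - 1\<close> as a
      divisor of \<open>q ^ n - 1\<close>.\<close>
    have ddvd: "d dvd n"
      by (rule power_minus_1_dvd_imp_dvd[of "int q"]) (use q2 d0 eq in auto)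
    obtain h where "monom 1 n - 1 = (monom 1 d - 1) * P * h"
      using P(2)[of d] d0 dn ddvd by (auto elim: dvdE)
    from arg_cong[OF this, of "\<lambda>p. poly p (int q)"]
    have "int q ^ n - 1 = (int q ^ d - 1) * (N * poly h (int q))"
      by (simp only: poly_mult poly_X_power_minus_1 N_def mult.assoc)
    moreover have "1 < int q ^ d" by (rule one_less_power) (use q2 d0 in auto)
    then have "int q ^ d - 1 \<noteq> 0" by linarith
    ultimately have "int (card (conj_class a)) = N * poly h (int q)"
      using eq by (simp add: mult.commute)
    then have "N dvd int (card (conj_class a))" by simp
    then show ?thesis by (simp add: nat_abs_dvd_iff)
  qed
  have Zclass: "b \<notin> Z" if "a \<notin> Z" "b \<in> conj_class a" for a b
  proof
    assume b: "b \<in> Z"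
    from conj_class_sym[OF that(2)] obtain g where g: "g \<noteq> 0" "a = g * b * inverse g"
      by (auto simp: conj_class_def)
    have "g * b = b * g" using b by (simp add: Z_def centralizer_def)
    with g have "a = b" by (simp add: mult.assoc)
    with b that(1) show False by simp
  qed
  \<comment> \<open>The noncentral elements are a disjoint union of conjugacy classes, each of size
    divisible by \<open>N\<close>.\<close>
  have "nat \<bar>N\<bar> dvd card (\<Union> (conj_class ` (- Z)))"
  proof (rule dvd_partition)
    show "\<forall>c1\<in>conj_class ` (- Z). \<forall>c2\<in>conj_class ` (- Z). c1 \<noteq> c2 \<longrightarrow> c1 \<inter> c2 = {}"
      using conj_class_subset conj_class_sym by blast
  qed (use class_dvd finS in auto)
  also have "\<Union> (conj_class ` (- Z)) = - Z"
    using conj_class_self Zclass by blast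
  finally have "N dvd int (card (- Z))" by (simp add: nat_abs_dvd_iff)
  also have "int (card (- Z)) = (int q ^ n - 1) - (int q - 1)"
  proof -
    have "card (- Z) + q = q ^ n"
      using card_Un_disjoint[OF finS finS, of "- Z" Z] n by (simp add: q_def Un_commute)
    then show ?thesis by (simp flip: of_nat_power of_nat_add) 
  qed
  finally have "N dvd int q - 1" using dvd_diff[OF N1] by fastforce
  then have "\<bar>N\<bar> \<le> int q - 1" using q2 by (intro zdvd_imp_le) auto
  with P(3)[of "int q"] q2 show False by (simp add: N_def)
qed

section \<open>Extensions of finite fields\<close>

text \<open>Multiplication by a nonzero element is injective on the finite set \<open>K\<close>,
  hence surjective, and so it reaches 1.\<close>

lemma subdivision_ring_finite:
  fixes K :: "'a::division_ring set"
  assumes fin: "finite K" and one: "1 \<in> K"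
    and diff: "\<And>x y. x \<in> K \<Longrightarrow> y \<in> K \<Longrightarrow> x - y \<in> K"
    and mult: "\<And>x y. x \<in> K \<Longrightarrow> y \<in> K \<Longrightarrow> x * y \<in> K"
  shows "subdivision_ring K"
proof -
  have "inverse x \<in> K" if x: "x \<in> K" for x
  proof (cases "x = 0")
    case False
    have "(\<lambda>y. x * y) ` K = K"
      by (rule endo_inj_surj[OF fin]) (use x mult False in \<open>auto simp: inj_on_def\<close>)
    then obtain y where "y \<in> K" "1 = x * y" using one by blast
    with False have "inverse x = y" by (metis inverse_unique)
    with \<open>y \<in> K\<close> show ?thesis by simp
  qed (use x in auto)
  with one diff mult show ?thesis by (simp add: subdivision_ring_def)
qed

text \<open>Multiplication by \<open>x\<close> permutes the nonzero elements; comparing their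
  products gives \<open>x ^ (card K - 1) = 1\<close> for nonzero \<open>x\<close>.\<close>

lemma power_card_eq_self:
  fixes K :: "'a::field set"
  assumes K: "subdivision_ring K" and fin: "finite K" and x: "x \<in> K"
  shows "x ^ card K = x"
proof (cases "x = 0")
  case True
  have "card K > 0" using x fin by (auto simp: card_gt_0_iff)
  with True show ?thesis by simp
next
  case False
  have inj: "inj_on (\<lambda>y. x * y) (K - {0})" using False by (auto simp: inj_on_def)
  have "(\<lambda>y. x * y) ` (K - {0}) = K - {0}"
    by (rule endo_inj_surj) (use fin x False inj subdivision_ringD(5)[OF K] in auto)
  then have "(\<Prod>y\<in>K - {0}. y) = (\<Prod>y\<in>K - {0}. x * y)"
    using prod.reindex[OF inj, of "\<lambda>y. y"] by simp
  also have "\<dots> = x ^ card (K - {0}) * (\<Prod>y\<in>K - {0}. y)"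
    by (simp add: prod.distrib)
  finally have "x ^ card (K - {0}) = 1" using fin by simp
  moreover have "card K = Suc (card (K - {0}))"
    using card.remove[OF fin subdivision_ringD(2)[OF K]] .
  ultimately show ?thesis by simp
qed

text \<open>The images of the naturals form the prime field, and \<open>K\<close> is a finite space
  over it.\<close>

lemma prime_char_of_finite_subdivision_ring:
  fixes K :: "'a::field set"
  assumes K: "subdivision_ring K" and fin: "finite K"
  obtains e where "prime CHAR('a)" "card K = CHAR('a) ^ e"
proof -
  let ?p = "CHAR('a)" and ?K0 = "range (of_nat :: nat \<Rightarrow> 'a)"
  have K0: "?K0 \<subseteq> K"
  proof clarify
    fix i show "(of_nat i :: 'a) \<in> K" by (induction i) (auto intro: subdivision_ringD[OF K])
  qed
  then have fin0: "finite ?K0" using fin by (rule finite_subset)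
  have "?p > 0"
  proof (rule ccontr)
    assume "\<not> ?p > 0"
    then have "inj (of_nat :: nat \<Rightarrow> 'a)"
      by (auto simp: inj_on_def of_nat_eq_iff_cong_CHAR)
    with fin0 show False by (auto dest: finite_imageD)
  qed
  then have p: "prime ?p" by (rule prime_CHAR_semidom)
  \<comment> \<open>In characteristic \<open>?p\<close> the multiple \<open>(?p - 1) * b\<close>
    acts as the negative of \<open>b\<close>, so differences remain images of naturals.\<close>
  have diff: "of_nat a - of_nat b = (of_nat (a + (?p - 1) * b) :: 'a)" for a b
  proof -
    have "a + (?p - 1) * b + b = a + ?p * b" using \<open>?p > 0\<close> by (cases ?p) auto
    then have "of_nat (a + (?p - 1) * b) + of_nat b = (of_nat (a + ?p * b) :: 'a)"
      by (simp only: flip: of_nat_add)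
    also have "\<dots> = of_nat a" by simp
    finally show ?thesis by (metis add_diff_cancel_right')
  qed
  have "subdivision_ring ?K0"
  proof (rule subdivision_ring_finite[OF fin0])
    show "1 \<in> ?K0" by (metis of_nat_1 rangeI)
    fix x y assume "x \<in> ?K0" "y \<in> ?K0"
    then obtain a b where "x = of_nat a" "y = of_nat b" by auto
    then show "x - y \<in> ?K0" "x * y \<in> ?K0"
      by (metis diff rangeI, metis of_nat_mult rangeI)
  qed
  then obtain e where e: "card K = card ?K0 ^ e"
    by (rule left_basis_exists[OF _ fin0 fin])
      (use K0 in \<open>auto intro: subdivision_ringD[OF K]\<close>)
  have "?K0 = of_nat ` {..<?p}"
  proof (intro equalityI subsetI)
    fix x assume "x \<in> ?K0"
    then obtain i where "x = of_nat i" by auto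
    then have "x = of_nat (i mod ?p)" by (simp add: of_nat_eq_iff_cong_CHAR)
    with \<open>?p > 0\<close> show "x \<in> of_nat ` {..<?p}" by auto
  qed auto
  moreover have "inj_on (of_nat :: nat \<Rightarrow> 'a) {..<?p}"
    by (auto simp: inj_on_def of_nat_eq_iff_cong_CHAR cong_def)
  ultimately have "card ?K0 = ?p" by (simp add: card_image)
  with e p show thesis using that by simp
qed

text \<open>Over an algebraically closed field the roots with multiplicity number
  \<open>degree f\<close>; a multiple root would also annihilate the derivative.\<close>

lemma card_roots_eq_degree:
  fixes f :: "'a::alg_closed_field poly"
  assumes f: "f \<noteq> 0" and sep: "\<And>x. poly f x = 0 \<Longrightarrow> poly (pderiv f) x \<noteq> 0"
  shows "card {x. poly f x = 0} = degree f"
proof -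
  obtain A where A: "size A = degree f" "f = smult (lead_coeff f) (\<Prod>x\<in>#A. [:-x, 1:])"
    using alg_closed_imp_factorization[OF f] by blast
  have "(\<Prod>x\<in>#B. [:-x, 1:]) \<noteq> (0 :: 'a poly) \<and> proots (\<Prod>x\<in>#B. [:-x, 1:]) = B" for B :: "'a multiset"
    by (induction B) (auto simp: proots_mult simp del: mult_pCons_left)
  then have "proots f = A"
    using A(2) f by (metis leading_coeff_0_iff proots_smult)
  then have size: "size (proots f) = degree f" using A by simp
  have "order x f = 1" if x: "poly f x = 0" for x
  proof -
    have "\<not> order x f \<ge> 2"
    proof
      assume "order x f \<ge> 2"
      then have "[:-x, 1:] ^ 2 dvd f" using order_1[of x f] power_le_dvd by blast
      then obtain g where "f = [:-x, 1:] ^ 2 * g" by (rule dvdE)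
      then have "f = [:-x, 1:] * ([:-x, 1:] * g)" by (simp only: power2_eq_square mult.assoc)
      then have "poly (pderiv f) x = 0" by (simp add: pderiv_mult del: mult_pCons_left)
      with sep x show False by blast
    qed
    moreover have "order x f > 0" using x f by (simp add: order_gt_0_iff)
    ultimately show ?thesis by simp
  qed
  then have "size (proots f) = (\<Sum>x\<in>{x. poly f x = 0}. 1)"
    unfolding size_multiset_overloaded_eq using f by (intro sum.cong) auto
  with size show ?thesis by simp
qed

text \<open>\<open>F\<close> consists of the roots of \<open>X ^ Q - X\<close>. The Frobenius
  identity makes it a field, and separability gives it exactly \<open>Q\<close> elements.\<close>

lemma finite_field_extension:
  fixes K :: "'a::alg_closed_field set"
  assumes K: "subdivision_ring K" and fin: "finite K" and s: "s \<ge> 1"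
  obtains F b where "subdivision_ring F" "finite F" "K \<subseteq> F" "card F = card K ^ s"
    "\<And>i. i < s \<Longrightarrow> b i \<in> F" "left_independent K s b"
proof -
  define q where "q = card K"
  define Q where "Q = q ^ s"
  define F where "F = {x :: 'a. x ^ Q = x}"
  obtain e where p: "prime CHAR('a)" and e: "q = CHAR('a) ^ e"
    using prime_char_of_finite_subdivision_ring[OF K fin] unfolding q_def by metis
  have Qp: "Q = CHAR('a) ^ (e * s)" by (simp add: Q_def e power_mult)
  have q2: "q \<ge> 2"
    using card_mono[OF fin, of "{0, 1}"] subdivision_ringD(1,2)[OF K] by (simp add: q_def)
  then have Q2: "Q \<ge> 2" using s self_le_power[of q s] by (simp add: Q_def)
  have ofQ: "(of_nat Q :: 'a) = 0"
  proof -
    have "e * s \<noteq> 0"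
    proof
      assume "e * s = 0"
      then have "Q = 1" by (simp only: Qp power_0)
      with Q2 show False by simp
    qed
    then show ?thesis by (simp add: Qp)
  qed
  have frob: "(x + y) ^ Q = x ^ Q + y ^ Q" for x y :: 'a
    by (rule freshmans_dream'[OF p Qp])
  have F: "subdivision_ring F"
    unfolding subdivision_ring_def
  proof (intro conjI ballI)
    fix x y assume xy: "x \<in> F" "y \<in> F"
    have "(x - y) ^ Q + y ^ Q = x ^ Q" using frob[of "x - y" y] by simp
    with xy show "x - y \<in> F" by (simp add: F_def) (metis add_diff_cancel)
    from xy show "x * y \<in> F" by (simp add: F_def power_mult_distrib)
  qed (auto simp: F_def power_inverse)
  have KF: "K \<subseteq> F"
  proof
    fix x assume x: "x \<in> K"
    \<comment> \<open>Iterating \<open>x ^ q = x\<close>; the instance \<open>i = s\<close> puts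
      \<open>x\<close> into \<open>F\<close>.\<close>
    have "x ^ (q ^ i) = x" for i
    proof (induction i)
      case (Suc i)
      have "x ^ (q ^ Suc i) = (x ^ (q ^ i)) ^ q" by (simp add: mult.commute flip: power_mult)
      also have "\<dots> = x" using Suc power_card_eq_self[OF K fin x] by (simp add: q_def)
      finally show ?case .
    qed simp
    then show "x \<in> F" by (simp add: F_def Q_def)
  qed
  define f where "f = (monom 1 Q - monom 1 1 :: 'a poly)"
  have deg: "degree f = Q"
  proof -
    have "degree (- monom 1 1 + monom 1 Q :: 'a poly) = degree (monom 1 Q :: 'a poly)"
      by (rule degree_add_eq_right) (use Q2 in \<open>simp add: degree_monom_eq\<close>)
    then show ?thesis by (simp add: f_def degree_monom_eq)
  qed
  have "f \<noteq> 0" using deg Q2 by auto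
  \<comment> \<open>The leading term of the derivative carries the factor \<open>Q\<close>, which is
    0 in this characteristic.\<close>
  moreover have "poly (pderiv f) x = -1" for x
    by (simp add: f_def pderiv_diff pderiv_monom ofQ poly_monom)
  ultimately have "card {x. poly f x = 0} = Q"
    using card_roots_eq_degree[of f] deg by simp
  moreover have "{x. poly f x = 0} = F"
    by (simp add: f_def F_def poly_monom)
  ultimately have cardF: "card F = Q" by simp
  then have finF: "finite F" using Q2 by (intro card_ge_0_finite) simp
  obtain t b where tb: "\<And>i. i < t \<Longrightarrow> b i \<in> F" "left_independent K t b" "card F = card K ^ t"
    by (rule left_basis_exists[OF K fin finF])
      (use KF in \<open>auto intro: subdivision_ringD[OF F]\<close>)
  \<comment> \<open>Both \<open>q ^ t\<close> and \<open>q ^ s\<close> count \<open>F\<close>, and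
    \<open>q\<close> exceeds 1.\<close>
  have "t = s" using tb(3) cardF q2 by (simp add: Q_def q_def)
  with tb show thesis using that[OF F finF KF, of b] by simp
qed

text \<open>
  Wedderburn's theorem cannot make \<open>'a\<close> an instance of class \<open>field\<close>, which the type constructor
  \<open>alg_closure\<close> requires; the centre is a field unconditionally and coincides with \<open>'a\<close> when
  \<open>'a\<close> is finite.
\<close>

typedef (overloaded) 'a centre = "centralizer UNIV :: 'a::division_ring set"
  by (rule exI[of _ 1]) (simp add: centralizer_def)

setup_lifting type_definition_centre

instantiation centre :: (division_ring) field
begin

lift_definition zero_centre :: "'a centre" is 0
  by (simp add: centralizer_def)

lift_definition one_centre :: "'a centre" is 1
  by (simp add: centralizer_def)

lift_definition plus_centre :: "'a centre \<Rightarrow> 'a centre \<Rightarrow> 'a centre" is "(+)"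
  by (rule subdivision_ringD[OF subdivision_ring_centralizer])

lift_definition minus_centre :: "'a centre \<Rightarrow> 'a centre \<Rightarrow> 'a centre" is "(-)"
  by (rule subdivision_ringD[OF subdivision_ring_centralizer])

lift_definition uminus_centre :: "'a centre \<Rightarrow> 'a centre" is "uminus"
  by (rule subdivision_ringD[OF subdivision_ring_centralizer])

lift_definition times_centre :: "'a centre \<Rightarrow> 'a centre \<Rightarrow> 'a centre" is "(*)"
  by (rule subdivision_ringD[OF subdivision_ring_centralizer])

lift_definition inverse_centre :: "'a centre \<Rightarrow> 'a centre" is "inverse"
  by (rule subdivision_ringD[OF subdivision_ring_centralizer])

definition divide_centre :: "'a centre \<Rightarrow> 'a centre \<Rightarrow> 'a centre" where
  "divide_centre x y = x * inverse y"

instance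
proof
  fix a b c :: "'a centre"
  show "a * b * c = a * (b * c)" by transfer (rule mult.assoc)
  show "a * b = b * a" by transfer (unfold centralizer_def, blast)
  show "1 * a = a" by transfer simp
  show "a + b + c = a + (b + c)" by transfer (rule add.assoc)
  show "a + b = b + a" by transfer (rule add.commute)
  show "0 + a = a" by transfer simp
  show "- a + a = 0" by transfer simp
  show "a - b = a + - b" by transfer simp
  show "(a + b) * c = a * c + b * c" by transfer (rule distrib_right)
  show "(0 :: 'a centre) \<noteq> 1" by transfer simp
  show "a \<noteq> 0 \<Longrightarrow> inverse a * a = 1" by transfer simp
  show "a div b = a * inverse b" by (rule divide_centre_def)
  show "inverse (0 :: 'a centre) = 0" by transfer simp
qed

end

text \<open>By \<open>wedderburn\<close> the ring equals its centre, so \<open>Abs_centre\<close> is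
  a ring isomorphism that can be followed by the embedding into the closure.\<close>

lemma finite_division_ring_embedding:
  assumes fin: "finite (UNIV :: 'a::division_ring set)"
  obtains h :: "'a::division_ring \<Rightarrow> 'a centre alg_closure"
    where "inj h" "h 1 = 1" "\<And>x y. h (x - y) = h x - h y" "\<And>x y. h (x * y) = h x * h y"
proof -
  have UNIV: "centralizer UNIV = (UNIV :: 'a set)"
    using wedderburn[OF fin] by (auto simp: centralizer_def)
  have Rep: "Rep_centre (Abs_centre x) = x" for x :: 'a
    by (rule Abs_centre_inverse) (simp add: UNIV)
  have hom: "Abs_centre (Rep_centre a) = a" for a :: "'a centre"
    by (rule Rep_centre_inverse)
  show thesis
  proof
    let ?h = "\<lambda>x :: 'a. to_ac (Abs_centre x)"
    show "inj ?h" by (rule injI) (metis Rep to_ac_eq_iff)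
    show "?h 1 = 1" by (simp flip: one_centre_def)
    have "Abs_centre (x - y) = Abs_centre x - Abs_centre y" for x y :: 'a
      by (metis Rep hom minus_centre.rep_eq)
    then show "?h (x - y) = ?h x - ?h y" for x y by simp
    have "Abs_centre (x * y) = Abs_centre x * Abs_centre y" for x y :: 'a
      by (metis Rep hom times_centre.rep_eq)
    then show "?h (x * y) = ?h x * ?h y" for x y by simp
  qed
qed

section \<open>The colouring of matrices over a finite division ring\<close>

text \<open>Padding with zero coefficients extends a combination of length \<open>m\<close> to the
  full length \<open>s\<close> of the basis, so one basis serves both rows and columns.\<close>

lemma left_independent_combination_eq_0:
  assumes ind: "left_independent K s b" and m: "m \<le> s" and K: "subdivision_ring K"
    and c: "\<And>i. i < m \<Longrightarrow> c i \<in> K" and eq: "(\<Sum>i<m. c i * b i) = 0" and i: "i < m"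
  shows "c i = 0"
proof -
  let ?c = "\<lambda>i. if i < m then c i else 0"
  have "(\<Sum>i<s. ?c i * b i) = (\<Sum>i<m. ?c i * b i)"
    by (rule sum.mono_neutral_right) (use m in auto)
  also have "\<dots> = (\<Sum>i<m. c i * b i)" by (rule sum.cong) auto
  finally have "(\<Sum>i<s. ?c i * b i) = 0" using eq by simp
  then have "?c i = 0"
    by (rule left_independentD[OF ind, rotated]) (use c i m subdivision_ringD(2)[OF K] in auto)
  with i show ?thesis by simp
qed

lemma colouring_finite:
  assumes fin: "finite (UNIV :: 'a::division_ring set)" and mn: "max m n \<ge> 1"
  obtains col :: "'a::division_ring mat \<Rightarrow> 'a centre alg_closure"
    where "\<And>A B. A \<in> carrier_mat m n \<Longrightarrow> B \<in> carrier_mat m n \<Longrightarrow> adjacent A B \<Longrightarrow> col A \<noteq> col B"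
      "|col ` carrier_mat m n| \<le>o |Func {..<max m n} (UNIV :: 'a set)|"
proof -
  let ?s = "max m n"
  obtain h :: "'a \<Rightarrow> 'a centre alg_closure" where inj: "inj h" and h1: "h 1 = 1"
    and hdiff: "\<And>x y. h (x - y) = h x - h y" and hmult: "\<And>x y. h (x * y) = h x * h y"
    using finite_division_ring_embedding[OF fin] by metis
  have h0: "h x = 0 \<longleftrightarrow> x = 0" for x
    using hdiff[of 0 0] injD[OF inj, of x 0] by auto
  define K where "K = range h"
  have finK: "finite K" using fin by (simp add: K_def)
  have K: "subdivision_ring K"
  proof (rule subdivision_ring_finite[OF finK])
    show "1 \<in> K" unfolding K_def by (metis h1 rangeI)
    show "x - y \<in> K" "x * y \<in> K" if "x \<in> K" "y \<in> K" for x y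
      using that by (auto simp: K_def simp flip: hdiff hmult)
  qed
  obtain F b where F: "subdivision_ring F" "finite F" "K \<subseteq> F" "card F = card K ^ ?s"
    and b: "\<And>i. i < ?s \<Longrightarrow> b i \<in> F" "left_independent K ?s b"
    using finite_field_extension[OF K finK mn] by metis
  define col where "col A = (\<Sum>i<m. \<Sum>j<n. b i * h (A $$ (i, j)) * b j)" for A
  have sumF: "(\<Sum>i<t. f i) \<in> F" if "\<And>i. i < t \<Longrightarrow> f i \<in> F" for t :: nat and f
    using that by (induction t) (auto intro: subdivision_ringD[OF F(1)])
  \<comment> \<open>Membership in \<open>F\<close> bounds the number of colours; the closure itself
    is infinite.\<close>
  have colF: "col A \<in> F" for A
    unfolding col_def using F(3) b(1)
    by (intro sumF subdivision_ringD(5)[OF F(1)]) (auto simp: K_def)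
  show thesis
  proof
    fix A B :: "'a mat" assume AB: "A \<in> carrier_mat m n" "B \<in> carrier_mat m n" "adjacent A B"
    then obtain u v where uv: "A - B = outer m n u v" and neq: "A \<noteq> B"
      by (auto simp: adjacent_iff_outer)
    have entry: "A $$ (i, j) - B $$ (i, j) = u i * v j" if "i < m" "j < n" for i j
      using arg_cong[OF uv, of "\<lambda>M. M $$ (i, j)"] AB(1,2) that by simp
    show "col A \<noteq> col B"
    proof
      assume "col A = col B"
      then have "0 = col A - col B" by simp
      also have "\<dots> = (\<Sum>i<m. \<Sum>j<n. b i * h (A $$ (i, j) - B $$ (i, j)) * b j)"
        by (simp add: col_def hdiff algebra_simps flip: sum_subtractf)
      \<comment> \<open>Commutativity of the closure separates the row factors from the column
        factors.\<close>
      also have "\<dots> = (\<Sum>i<m. \<Sum>j<n. (h (u i) * b i) * (h (v j) * b j))"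
        by (intro sum.cong refl) (simp add: entry hmult mult_ac)
      also have "\<dots> = (\<Sum>i<m. h (u i) * b i) * (\<Sum>j<n. h (v j) * b j)"
        by (simp add: sum_product)
      finally consider "(\<Sum>i<m. h (u i) * b i) = 0" | "(\<Sum>j<n. h (v j) * b j) = 0" by auto
      then have "(\<forall>i<m. u i = 0) \<or> (\<forall>j<n. v j = 0)"
      proof cases
        case 1
        have "h (u i) = 0" if "i < m" for i
          by (rule left_independent_combination_eq_0[OF b(2) _ K _ 1 that]) (auto simp: K_def)
        then show ?thesis by (simp add: h0)
      next
        case 2
        have "h (v j) = 0" if "j < n" for j
          by (rule left_independent_combination_eq_0[OF b(2) _ K _ 2 that]) (auto simp: K_def)
        then show ?thesis by (simp add: h0)
      qed
      then have "A $$ (i, j) = B $$ (i, j)" if "i < m" "j < n" for i j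
        using entry[OF that] that by auto
      then have "A = B" using AB(1,2) by (intro eq_matI) auto
      with neq show False ..
    qed
  next
    have FuncE: "Func {..<?s} (UNIV :: 'a set) = PiE {..<?s} (\<lambda>_. UNIV)"
      by (auto simp: Func_def PiE_def extensional_def)
    have "card F = card (Func {..<?s} (UNIV :: 'a set))"
      unfolding FuncE F(4) by (simp add: card_PiE K_def card_image inj)
    moreover have "finite (Func {..<?s} (UNIV :: 'a set))"
      unfolding FuncE by (intro finite_PiE fin) auto
    ultimately obtain g where "bij_betw g F (Func {..<?s} (UNIV :: 'a set))"
      using finite_same_card_bij[OF F(2)] by metis
    then have "|F| \<le>o |Func {..<?s} (UNIV :: 'a set)|"
      by (intro card_of_ordLeqI[of g]) (auto simp: bij_betw_def)
    moreover have "|col ` carrier_mat m n| \<le>o |F|"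
      by (rule card_of_mono1) (use colF in auto)
    ultimately show "|col ` carrier_mat m n| \<le>o |Func {..<?s} (UNIV :: 'a set)|"
      using ordLeq_transitive by blast
  qed
qed

theorem theorem2p8:
  fixes m n m' n' s k :: nat
  assumes "m \<ge> 1" and "n \<ge> 1" and "m' \<ge> 1" and "n' \<ge> 1"
    and "s = max m n" and "k = max m' n'"
  shows "(\<exists>\<phi> :: 'a::division_ring mat \<Rightarrow> 'b::division_ring mat. graph_hom m n m' n' \<phi>) \<longleftrightarrow>
    |UNIV :: 'a set| ^c |{..<s}| \<le>o |UNIV :: 'b set| ^c |{..<k}|"
proof
  assume "\<exists>\<phi> :: 'a mat \<Rightarrow> 'b mat. graph_hom m n m' n' \<phi>"
  then show "|UNIV :: 'a set| ^c |{..<s}| \<le>o |UNIV :: 'b set| ^c |{..<k}|"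
    using graph_hom_imp_card_le assms unfolding cexp_UNIV_lessThan by blast
next
  assume "|UNIV :: 'a set| ^c |{..<s}| \<le>o |UNIV :: 'b set| ^c |{..<k}|"
  then have le: "|Func {..<max m n} (UNIV :: 'a set)| \<le>o |Func {..<max m' n'} (UNIV :: 'b set)|"
    unfolding cexp_UNIV_lessThan assms(5,6) .
  have mn: "max m n \<ge> 1" using assms(1) by simp
  show "\<exists>\<phi> :: 'a mat \<Rightarrow> 'b mat. graph_hom m n m' n' \<phi>"
  proof (cases "finite (UNIV :: 'a set)")
    case True
    show ?thesis
    proof (rule colouring_finite[OF True mn])
      fix col :: "'a mat \<Rightarrow> 'a centre alg_closure"
      assume col: "\<And>A B. A \<in> carrier_mat m n \<Longrightarrow> B \<in> carrier_mat m n \<Longrightarrow> adjacent A B \<Longrightarrow> col A \<noteq> col B"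
        and card: "|col ` carrier_mat m n| \<le>o |Func {..<max m n} (UNIV :: 'a set)|"
      show ?thesis
        by (rule graph_hom_of_colouring[OF assms(3,4) col ordLeq_transitive[OF card le]])
    qed
  next
    case False
    \<comment> \<open>Here the identity serves as colouring.\<close>
    have "A \<noteq> B" if "A \<in> carrier_mat m n" "B \<in> carrier_mat m n" "adjacent A B" for A B :: "'a mat"
      using that by (simp add: adjacent_iff_outer)
    moreover have "|(\<lambda>A :: 'a mat. A) ` carrier_mat m n| \<le>o |Func {..<max m' n'} (UNIV :: 'b set)|"
      using ordLeq_transitive[OF card_of_carrier_mat_infinite_le_Func[OF False mn] le] by simp
    ultimately show ?thesis
      by (rule graph_hom_of_colouring[OF assms(3,4)])
  qed
qed

end
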